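(* Let $G$ be a compact Lie group and let $p\colon E\to B$ be a $G$-fibration with $B$ $G$-connected and $B^G\neq\varnothing$. If $F=p^{-1}(b_0)$ for some $b_0\in B^G$, then $$\mathrm{TC}_G(E)+1\ \le\ (\mathrm{TC}_G(F)+1)(\mathrm{cat}_G(B\times B)+1),$$ where $G$ acts diagonally on $B\times B$.
   Context: A $G$-fibration is a $G$-map with the $G$-equivariant homotopy lifting property with respect to all $G$-spaces. For a closed subgroup $H\le G$, $X^H$ is the $H$-fixed-point set; a $G$-space $X$ is $G$-connected if $X^H$ is path-connected for every closed subgroup $H\le G$. Equivariant LS category: a $G$-invariant open subset $U\subseteq X$ is $G$-categorical if the inclusion $U\hookrightarrow X$ is $G$-homotopic to a $G$-map whose image lies in a single orbit. $\mathrm{cat}_G(X)$ is the least integer $n\ge0$ such that $X$ can be covered by $n+1$ $G$-categorical sets ($\infty$ if none exists). Equivariant topological complexity: $\mathrm{TC}_G(X)=\mathrm{secat}_G(\pi_X)$, where $\pi_X\colon X^I\to X\times X$, $\gamma\mapsto(\gamma(0),\gamma(1))$, with action $(g\gamma)(t)=g\gamma(t)$ on $X^I$ and diagonal action on $X\times X$. For a $G$-map $q\colon A\to C$, $\mathrm{secat}_G(q)$ is the least $n\ge 0$ such that $C$ is covered by $n+1$ $G$-invariant open subsets $U_i$ each admitting a $G$-map $s_i\colon U_i\to A$ with $q\circ s_i$ $G$-homotopic to the inclusion $U_i\hookrightarrow C$ ($\infty$ if none).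
   Formalization: The base B is additionally assumed to be a T0 space; with no separation axiom the claim fails, e.g. for Z/2 reflecting a circle with one fixed point doubled into two indistinguishable points that are swapped, and p the identity. *)

theory Defs
  imports "HOL-Analysis.Analysis" "HOL-Algebra.Group"
begin

section \<open>Compact Lie groups\<close>

text \<open>
  Groups are those of HOL-Algebra; the topology is a separate parameter whose underlying set is
  the carrier.  Charts take values in \<^term>\<open>Euclidean_space n\<close>, the functions
  \<^typ>\<open>nat \<Rightarrow> real\<close> that vanish from \<open>n\<close> on, so that every dimension \<open>n \<ge> 0\<close> is allowed;
  in particular finite groups are compact Lie groups (\<open>n = 0\<close>).
\<close>

definition topological_group :: "('g, 'm) monoid_scheme \<Rightarrow> 'g topology \<Rightarrow> bool" where
  "topological_group G T \<longleftrightarrow>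
     group G \<and> topspace T = carrier G \<and>
     continuous_map (prod_topology T T) T (\<lambda>(x, y). x \<otimes>\<^bsub>G\<^esub> y) \<and>
     continuous_map T T (\<lambda>x. inv\<^bsub>G\<^esub> x)"

definition partial_deriv :: "nat \<Rightarrow> ((nat \<Rightarrow> real) \<Rightarrow> real) \<Rightarrow> (nat \<Rightarrow> real) \<Rightarrow> real" where
  "partial_deriv i f x = deriv (\<lambda>t. f (x(i := t))) (x i)"

text \<open>\<open>Ck_on n k U f\<close> is meant for \<open>U\<close> open in \<^term>\<open>Euclidean_space n\<close>; values of \<open>f\<close> outside
  \<open>U\<close> play no role.\<close>

fun Ck_on :: "nat \<Rightarrow> nat \<Rightarrow> (nat \<Rightarrow> real) set \<Rightarrow> ((nat \<Rightarrow> real) \<Rightarrow> real) \<Rightarrow> bool" where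
  "Ck_on n 0 U f \<longleftrightarrow> continuous_map (subtopology (Euclidean_space n) U) euclideanreal f"
| "Ck_on n (Suc k) U f \<longleftrightarrow>
     continuous_map (subtopology (Euclidean_space n) U) euclideanreal f \<and>
     (\<forall>i<n. (\<forall>x\<in>U. (\<lambda>t. f (x(i := t))) field_differentiable (at (x i))) \<and>
            Ck_on n k U (partial_deriv i f))"

definition smooth_map_on ::
  "nat \<Rightarrow> nat \<Rightarrow> (nat \<Rightarrow> real) set \<Rightarrow> ((nat \<Rightarrow> real) \<Rightarrow> nat \<Rightarrow> real) \<Rightarrow> bool" where
  "smooth_map_on n m U f \<longleftrightarrow> (\<forall>j<m. \<forall>k. Ck_on n k U (\<lambda>x. f x j))"

type_synonym 'a chart = "'a set \<times> ('a \<Rightarrow> nat \<Rightarrow> real)"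

definition is_chart :: "nat \<Rightarrow> 'a topology \<Rightarrow> 'a chart \<Rightarrow> bool" where
  "is_chart n T = (\<lambda>(V, \<phi>).
     openin T V \<and> openin (Euclidean_space n) (\<phi> ` V) \<and>
     homeomorphic_map (subtopology T V) (subtopology (Euclidean_space n) (\<phi> ` V)) \<phi>)"

definition smooth_atlas :: "nat \<Rightarrow> 'a topology \<Rightarrow> 'a chart set \<Rightarrow> bool" where
  "smooth_atlas n T \<A> \<longleftrightarrow>
     (\<forall>c\<in>\<A>. is_chart n T c) \<and> (\<Union>(V, \<phi>)\<in>\<A>. V) = topspace T \<and>
     (\<forall>(V, \<phi>)\<in>\<A>. \<forall>(W, \<psi>)\<in>\<A>. smooth_map_on n n (\<phi> ` (V \<inter> W)) (\<lambda>u. \<psi> (inv_into V \<phi> u)))"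

text \<open>The identification of the space of dimension \<open>n + n\<close> with the square of the one of
  dimension \<open>n\<close>.\<close>

definition fst_half :: "nat \<Rightarrow> (nat \<Rightarrow> real) \<Rightarrow> nat \<Rightarrow> real" where
  "fst_half n z = (\<lambda>i. if i < n then z i else 0)"

definition snd_half :: "nat \<Rightarrow> (nat \<Rightarrow> real) \<Rightarrow> nat \<Rightarrow> real" where
  "snd_half n z = (\<lambda>i. if i < n then z (n + i) else 0)"

definition smooth_inverse :: "('g, 'm) monoid_scheme \<Rightarrow> nat \<Rightarrow> 'g chart set \<Rightarrow> bool" where
  "smooth_inverse G n \<A> \<longleftrightarrow>
     (\<forall>(V, \<phi>)\<in>\<A>. \<forall>(W, \<psi>)\<in>\<A>.
        smooth_map_on n n (\<phi> ` {x \<in> V. inv\<^bsub>G\<^esub> x \<in> W}) (\<lambda>u. \<psi> (inv\<^bsub>G\<^esub> (inv_into V \<phi> u))))"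

definition smooth_mult :: "('g, 'm) monoid_scheme \<Rightarrow> nat \<Rightarrow> 'g chart set \<Rightarrow> bool" where
  "smooth_mult G n \<A> \<longleftrightarrow>
     (\<forall>(V, \<phi>)\<in>\<A>. \<forall>(V', \<phi>')\<in>\<A>. \<forall>(W, \<psi>)\<in>\<A>.
        smooth_map_on (n + n) n
          {z \<in> topspace (Euclidean_space (n + n)).
             fst_half n z \<in> \<phi> ` V \<and> snd_half n z \<in> \<phi>' ` V' \<and>
             inv_into V \<phi> (fst_half n z) \<otimes>\<^bsub>G\<^esub> inv_into V' \<phi>' (snd_half n z) \<in> W}
          (\<lambda>z. \<psi> (inv_into V \<phi> (fst_half n z) \<otimes>\<^bsub>G\<^esub> inv_into V' \<phi>' (snd_half n z))))"

definition Lie_group :: "('g, 'm) monoid_scheme \<Rightarrow> 'g topology \<Rightarrow> bool" where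
  "Lie_group G T \<longleftrightarrow>
     topological_group G T \<and> Hausdorff_space T \<and> second_countable T \<and>
     (\<exists>n \<A>. smooth_atlas n T \<A> \<and> smooth_mult G n \<A> \<and> smooth_inverse G n \<A>)"

definition compact_Lie_group :: "('g, 'm) monoid_scheme \<Rightarrow> 'g topology \<Rightarrow> bool" where
  "compact_Lie_group G T \<longleftrightarrow> Lie_group G T \<and> compact_space T"


section \<open>G-spaces, G-maps and G-homotopies\<close>

text \<open>An action is a function \<open>'g \<Rightarrow> 'a \<Rightarrow> 'a\<close> of which only the values on the carrier and on the
  space matter (the library's \<open>group_action\<close> would force it to be undefined elsewhere, which
  excludes plain restriction to invariant subspaces).  No separation axiom is built in.\<close>

type_synonym ('g, 'a) act = "'g \<Rightarrow> 'a \<Rightarrow> 'a"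

definition G_space ::
  "('g, 'm) monoid_scheme \<Rightarrow> 'g topology \<Rightarrow> 'a topology \<Rightarrow> ('g, 'a) act \<Rightarrow> bool" where
  "G_space G T X a \<longleftrightarrow>
     continuous_map (prod_topology T X) X (\<lambda>(g, x). a g x) \<and>
     (\<forall>x\<in>topspace X. a \<one>\<^bsub>G\<^esub> x = x) \<and>
     (\<forall>g\<in>carrier G. \<forall>h\<in>carrier G. \<forall>x\<in>topspace X. a (g \<otimes>\<^bsub>G\<^esub> h) x = a g (a h x))"

definition diag_act :: "('g, 'a) act \<Rightarrow> ('g, 'b) act \<Rightarrow> ('g, 'a \<times> 'b) act" where
  "diag_act a b = (\<lambda>g (x, y). (a g x, b g y))"

definition fixed_points :: "'g set \<Rightarrow> 'a topology \<Rightarrow> ('g, 'a) act \<Rightarrow> 'a set" where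
  "fixed_points H X a = {x \<in> topspace X. \<forall>h\<in>H. a h x = x}"

definition G_connected ::
  "('g, 'm) monoid_scheme \<Rightarrow> 'g topology \<Rightarrow> 'a topology \<Rightarrow> ('g, 'a) act \<Rightarrow> bool" where
  "G_connected G T X a \<longleftrightarrow>
     (\<forall>H. subgroup H G \<and> closedin T H \<longrightarrow> path_connectedin X (fixed_points H X a))"

definition G_invariant :: "('g, 'm) monoid_scheme \<Rightarrow> ('g, 'a) act \<Rightarrow> 'a set \<Rightarrow> bool" where
  "G_invariant G a U \<longleftrightarrow> (\<forall>g\<in>carrier G. \<forall>x\<in>U. a g x \<in> U)"

definition G_orbit :: "('g, 'm) monoid_scheme \<Rightarrow> ('g, 'a) act \<Rightarrow> 'a \<Rightarrow> 'a set" where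
  "G_orbit G a x = {a g x | g. g \<in> carrier G}"

definition equivariant ::
  "('g, 'm) monoid_scheme \<Rightarrow> 'a topology \<Rightarrow> ('g, 'a) act \<Rightarrow> ('g, 'b) act \<Rightarrow> ('a \<Rightarrow> 'b) \<Rightarrow> bool" where
  "equivariant G X a b f \<longleftrightarrow> (\<forall>g\<in>carrier G. \<forall>x\<in>topspace X. f (a g x) = b g (f x))"

definition G_map ::
  "('g, 'm) monoid_scheme \<Rightarrow> 'a topology \<Rightarrow> ('g, 'a) act \<Rightarrow> 'b topology \<Rightarrow> ('g, 'b) act
    \<Rightarrow> ('a \<Rightarrow> 'b) \<Rightarrow> bool" where
  "G_map G X a Y b f \<longleftrightarrow> continuous_map X Y f \<and> equivariant G X a b f"

definition G_homotopic ::
  "('g, 'm) monoid_scheme \<Rightarrow> 'a topology \<Rightarrow> ('g, 'a) act \<Rightarrow> 'b topology \<Rightarrow> ('g, 'b) act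
    \<Rightarrow> ('a \<Rightarrow> 'b) \<Rightarrow> ('a \<Rightarrow> 'b) \<Rightarrow> bool" where
  "G_homotopic G X a Y b = homotopic_with (equivariant G X a b) X Y"


section \<open>Free path spaces\<close>

text \<open>Paths are made extensional outside \<open>{0..1}\<close>, so that a path is determined by its values on
  the unit interval.  The topology is the compact-open one.\<close>

definition paths :: "'a topology \<Rightarrow> (real \<Rightarrow> 'a) set" where
  "paths X = {\<gamma>. pathin X \<gamma> \<and> \<gamma> \<in> extensional {0..1}}"

definition path_space :: "'a topology \<Rightarrow> (real \<Rightarrow> 'a) topology" where
  "path_space X = topology_generated_by
     {{\<gamma> \<in> paths X. \<gamma> ` K \<subseteq> U} | K U. compact K \<and> K \<subseteq> {0..1} \<and> openin X U}"

definition path_act :: "('g, 'a) act \<Rightarrow> ('g, real \<Rightarrow> 'a) act" where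
  "path_act a = (\<lambda>g \<gamma>. restrict (\<lambda>t. a g (\<gamma> t)) {0..1})"

definition path_ends :: "(real \<Rightarrow> 'a) \<Rightarrow> 'a \<times> 'a" where
  "path_ends \<gamma> = (\<gamma> 0, \<gamma> 1)"


section \<open>G-fibrations\<close>

definition G_lifting ::
  "('g, 'm) monoid_scheme \<Rightarrow> 'x topology \<Rightarrow> ('g, 'x) act \<Rightarrow> 'e topology \<Rightarrow> ('g, 'e) act
    \<Rightarrow> 'b topology \<Rightarrow> ('g, 'b) act \<Rightarrow> ('e \<Rightarrow> 'b) \<Rightarrow> bool" where
  "G_lifting G X c E a B b p \<longleftrightarrow>
     (\<forall>f h. G_map G X c E a f \<and>
        continuous_map (prod_topology (top_of_set {0..1::real}) X) B h \<and>
        (\<forall>t\<in>{0..1}. equivariant G X c b (\<lambda>x. h (t, x))) \<and>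
        (\<forall>x\<in>topspace X. h (0, x) = p (f x)) \<longrightarrow>
        (\<exists>k. continuous_map (prod_topology (top_of_set {0..1::real}) X) E k \<and>
             (\<forall>t\<in>{0..1}. equivariant G X c a (\<lambda>x. k (t, x))) \<and>
             (\<forall>x\<in>topspace X. k (0, x) = f x) \<and>
             (\<forall>t\<in>{0..1}. \<forall>x\<in>topspace X. p (k (t, x)) = h (t, x))))"

text \<open>A formula cannot quantify over the type of the test space.  The bound variable \<open>X\<close> below
  ranges over all G-spaces whose points are of type \<^typ>\<open>'e \<times> (real \<Rightarrow> 'b)\<close>.  This is no
  restriction: that type accommodates the fibre product of \<open>E\<close> and the path space of \<open>B\<close>,
  from which every lifting problem over any G-space of any type is pulled back; see
  \<open>G_fibration_lifting\<close> below.\<close>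

definition G_fibration ::
  "('g, 'm) monoid_scheme \<Rightarrow> 'g topology \<Rightarrow> 'e topology \<Rightarrow> ('g, 'e) act
    \<Rightarrow> 'b topology \<Rightarrow> ('g, 'b) act \<Rightarrow> ('e \<Rightarrow> 'b) \<Rightarrow> bool" where
  "G_fibration G T E a B b p \<longleftrightarrow>
     G_map G E a B b p \<and>
     (\<forall>(X :: ('e \<times> (real \<Rightarrow> 'b)) topology) c. G_space G T X c \<longrightarrow> G_lifting G X c E a B b p)"

subsection \<open>The lifting property for test spaces of arbitrary type\<close>

lemma topspace_path_space [simp]: "topspace (path_space X) = paths X"
proof -
  let ?S = "{{\<gamma> \<in> paths X. \<gamma> ` K \<subseteq> U} | K U. compact K \<and> K \<subseteq> {0..1} \<and> openin X U}"
  have "{\<gamma> \<in> paths X. \<gamma> ` {} \<subseteq> topspace X} \<in> ?S"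
    by (rule CollectI, rule exI[of _ "{}"], rule exI[of _ "topspace X"]) simp
  then have "paths X \<in> ?S" by simp
  then have "\<Union>?S = paths X" by blast
  then show ?thesis
    unfolding path_space_def topology_generated_by_topspace .
qed

lemma path_eval_continuous:
  "continuous_map (prod_topology (top_of_set {0..1::real}) (path_space X)) X (\<lambda>(t, \<gamma>). \<gamma> t)"
proof -
  have mem: "\<gamma> t \<in> topspace X" if "t \<in> {0..1}" "\<gamma> \<in> paths X" for t \<gamma>
    using that unfolding paths_def pathin_def continuous_map_def by auto
  have op: "openin (prod_topology (top_of_set {0..1::real}) (path_space X))
     {z \<in> topspace (prod_topology (top_of_set {0..1::real}) (path_space X)).
        (\<lambda>(t, \<gamma>). \<gamma> t) z \<in> U}" if U: "openin X U" for U
    unfolding openin_prod_topology_alt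
  proof (intro allI impI)
    fix t \<gamma>
    assume "(t, \<gamma>) \<in> {z \<in> topspace (prod_topology (top_of_set {0..1::real}) (path_space X)).
        (\<lambda>(t, \<gamma>). \<gamma> t) z \<in> U}"
    then have t: "t \<in> {0..1}" and \<gamma>: "\<gamma> \<in> paths X" and tU: "\<gamma> t \<in> U" by auto
    have "openin (top_of_set {0..1}) {s \<in> {0..1}. \<gamma> s \<in> U}"
      using \<gamma> U openin_continuous_map_preimage[of "top_of_set {0..1}" X \<gamma> U]
      by (simp add: paths_def pathin_def)
    then have "\<exists>e>0. \<forall>s\<in>{0..1}. dist s t < e \<longrightarrow> s \<in> {s \<in> {0..1}. \<gamma> s \<in> U}"
      using t tU unfolding openin_euclidean_subtopology_iff by blast
    then obtain e where e: "e > 0" "\<And>s. s \<in> {0..1} \<Longrightarrow> dist s t < e \<Longrightarrow> \<gamma> s \<in> U"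
      by blast
    define K where "K = cball t (e/2) \<inter> {0..1}"
    define N where "N = ball t (e/2) \<inter> {0..1}"
    have K: "compact K" "K \<subseteq> {0..1}" unfolding K_def by (auto intro: compact_Int)
    have KU: "\<gamma> ` K \<subseteq> U"
      using e by (auto simp: K_def dist_commute)
    have N: "openin (top_of_set {0..1}) N" "t \<in> N" "N \<subseteq> K"
      using e(1) t unfolding N_def K_def by (auto simp: openin_open)
    define W where "W = {\<gamma> \<in> paths X. \<gamma> ` K \<subseteq> U}"
    have "openin (path_space X) W"
      unfolding path_space_def W_def
      by (rule topology_generated_by_Basis) (use K U in blast)
    moreover have "\<gamma> \<in> W" using \<gamma> KU by (simp add: W_def)
    moreover have "N \<times> W \<subseteq> {z \<in> topspace (prod_topology (top_of_set {0..1::real}) (path_space X)).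
        (\<lambda>(t, \<gamma>). \<gamma> t) z \<in> U}"
      using N K unfolding W_def by auto
    ultimately show "\<exists>N W. openin (top_of_set {0..1}) N \<and> openin (path_space X) W \<and> t \<in> N \<and>
       \<gamma> \<in> W \<and> N \<times> W \<subseteq> {z \<in> topspace (prod_topology (top_of_set {0..1::real}) (path_space X)).
        (\<lambda>(t, \<gamma>). \<gamma> t) z \<in> U}"
      using N by blast
  qed
  show ?thesis
    unfolding continuous_map_def using op mem by auto
qed

lemma path_curry_continuous:
  assumes h: "continuous_map (prod_topology (top_of_set {0..1::real}) Y) X h"
  shows "continuous_map Y (path_space X) (\<lambda>y. restrict (\<lambda>t. h (t, y)) {0..1})"
proof -
  have P: "restrict (\<lambda>t. h (t, y)) {0..1} \<in> paths X" if "y \<in> topspace Y" for y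
  proof -
    have "continuous_map (top_of_set {0..1::real}) X (h \<circ> (\<lambda>t. (t, y)))"
      by (rule continuous_map_compose[OF _ h]) (use that in \<open>auto intro!: continuous_map_pairedI\<close>)
    then have "continuous_map (top_of_set {0..1::real}) X (restrict (\<lambda>t. h (t, y)) {0..1})"
      by (rule continuous_map_eq) auto
    then show ?thesis by (simp add: paths_def pathin_def)
  qed
  have op: "openin Y {y \<in> topspace Y. (restrict (\<lambda>t. h (t, y)) {0..1}) ` K \<subseteq> U}"
    if K: "compact K" "K \<subseteq> {0..1}" and U: "openin X U" for K U
  proof (subst openin_subopen, intro ballI)
    fix y assume "y \<in> {y \<in> topspace Y. (restrict (\<lambda>t. h (t, y)) {0..1}) ` K \<subseteq> U}"
    then have y: "y \<in> topspace Y" and yU: "\<And>t. t \<in> K \<Longrightarrow> h (t, y) \<in> U" using K by force+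
    define W where "W = {z \<in> topspace (prod_topology (top_of_set {0..1::real}) Y). h z \<in> U}"
    have W: "openin (prod_topology (top_of_set {0..1::real}) Y) W"
      using h U unfolding continuous_map_def W_def by blast
    have Kc: "compactin (top_of_set {0..1}) K"
      using K by (simp add: compactin_subtopology)
    have "K \<times> {y} \<subseteq> W" using y yU K unfolding W_def by auto
    then obtain A V where AV: "openin Y V" "y \<in> V" "K \<subseteq> A" "A \<times> V \<subseteq> W"
      using tube_lemma_left[OF W Kc y] by auto
    have "V \<subseteq> {y \<in> topspace Y. (restrict (\<lambda>t. h (t, y)) {0..1}) ` K \<subseteq> U}"
    proof
      fix v assume v: "v \<in> V"
      then have "v \<in> topspace Y" using AV openin_subset by blast
      moreover have "h (t, v) \<in> U" if "t \<in> K" for t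
        using v AV that unfolding W_def by blast
      ultimately show "v \<in> {y \<in> topspace Y. (restrict (\<lambda>t. h (t, y)) {0..1}) ` K \<subseteq> U}"
        using K by auto
    qed
    then show "\<exists>V. openin Y V \<and> y \<in> V \<and>
        V \<subseteq> {y \<in> topspace Y. (restrict (\<lambda>t. h (t, y)) {0..1}) ` K \<subseteq> U}"
      using AV by blast
  qed
  show ?thesis
    unfolding path_space_def
  proof (rule continuous_on_generated_topo)
    fix S assume "S \<in> {{\<gamma> \<in> paths X. \<gamma> ` K \<subseteq> U} | K U. compact K \<and> K \<subseteq> {0..1} \<and> openin X U}"
    then obtain K U where S: "S = {\<gamma> \<in> paths X. \<gamma> ` K \<subseteq> U}"
      and KU: "compact K" "K \<subseteq> {0..1}" "openin X U" by blast
    have "(\<lambda>y. restrict (\<lambda>t. h (t, y)) {0..1}) -` S \<inter> topspace Y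
        = {y \<in> topspace Y. (restrict (\<lambda>t. h (t, y)) {0..1}) ` K \<subseteq> U}"
      unfolding S using P by auto
    then show "openin Y ((\<lambda>y. restrict (\<lambda>t. h (t, y)) {0..1}) -` S \<inter> topspace Y)"
      using op[OF KU] by simp
  next
    have "(\<Union> {{\<gamma> \<in> paths X. \<gamma> ` K \<subseteq> U} | K U. compact K \<and> K \<subseteq> {0..1} \<and> openin X U}) = paths X"
      using topspace_path_space[of X] unfolding path_space_def topology_generated_by_topspace .
    then show "(\<lambda>y. restrict (\<lambda>t. h (t, y)) {0..1}) ` topspace Y
       \<subseteq> \<Union> {{\<gamma> \<in> paths X. \<gamma> ` K \<subseteq> U} | K U. compact K \<and> K \<subseteq> {0..1} \<and> openin X U}"
      using P by auto
  qed
qed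

lemma G_space_closed:
  assumes "topological_group G T" "G_space G T X a" "g \<in> carrier G" "x \<in> topspace X"
  shows "a g x \<in> topspace X"
proof -
  have "(\<lambda>(g, x). a g x) \<in> topspace (prod_topology T X) \<rightarrow> topspace X"
    using assms(2) by (auto simp: G_space_def continuous_map_def)
  then have "(\<lambda>(g, x). a g x) (g, x) \<in> topspace X"
    by (rule funcset_mem) (use assms in \<open>simp add: topological_group_def\<close>)
  then show ?thesis by simp
qed

lemma G_space_path_space:
  assumes G: "topological_group G T" and X: "G_space G T X a"
  shows "G_space G T (path_space X) (path_act a)"
proof -
  have mem: "\<gamma> t \<in> topspace X" if "t \<in> {0..1}" "\<gamma> \<in> paths X" for t \<gamma>
    using that unfolding paths_def pathin_def continuous_map_def by auto
  let ?I = "top_of_set {0..1::real}"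
  let ?Z = "prod_topology ?I (prod_topology T (path_space X))"
  have ev: "continuous_map ?Z X (\<lambda>z. (\<lambda>(t, \<gamma>). \<gamma> t) (fst z, snd (snd z)))"
    by (intro continuous_map_compose[OF _ path_eval_continuous, unfolded o_def]
        continuous_map_pairedI continuous_map_fst
        continuous_map_snd [THEN continuous_map_compose, unfolded o_def, OF continuous_map_snd])
  have g: "continuous_map ?Z T (\<lambda>z. fst (snd z))"
    by (rule continuous_map_snd [THEN continuous_map_compose, unfolded o_def, OF continuous_map_fst])
  have a: "continuous_map (prod_topology T X) X (\<lambda>(g, x). a g x)"
    using X by (simp add: G_space_def)
  have "continuous_map ?Z X (\<lambda>z. (\<lambda>(g, x). a g x) (fst (snd z), (\<lambda>(t, \<gamma>). \<gamma> t) (fst z, snd (snd z))))"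
    by (rule continuous_map_compose[OF continuous_map_pairedI[OF g ev] a, unfolded o_def])
  then have "continuous_map (prod_topology T (path_space X)) (path_space X)
     (\<lambda>y. restrict (\<lambda>t. (\<lambda>z. (\<lambda>(g, x). a g x) (fst (snd z), (\<lambda>(t, \<gamma>). \<gamma> t) (fst z, snd (snd z)))) (t, y)) {0..1})"
    by (rule path_curry_continuous)
  then have c: "continuous_map (prod_topology T (path_space X)) (path_space X) (\<lambda>(g, \<gamma>). path_act a g \<gamma>)"
    by (simp add: path_act_def case_prod_unfold)
  have exts: "\<gamma> \<in> extensional {0..1}" if "\<gamma> \<in> paths X" for \<gamma> using that by (simp add: paths_def)
  show ?thesis
    unfolding G_space_def
  proof (intro conjI ballI c)
    fix \<gamma> assume "\<gamma> \<in> topspace (path_space X)"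
    then have \<gamma>: "\<gamma> \<in> paths X" by simp
    show "path_act a \<one>\<^bsub>G\<^esub> \<gamma> = \<gamma>"
      using X mem[OF _ \<gamma>] exts[OF \<gamma>]
      by (intro HOL.ext) (auto simp: path_act_def G_space_def extensional_def restrict_def)
    fix g h assume "g \<in> carrier G" "h \<in> carrier G"
    then show "path_act a (g \<otimes>\<^bsub>G\<^esub> h) \<gamma> = path_act a g (path_act a h \<gamma>)"
      using X mem[OF _ \<gamma>]
      by (intro HOL.ext) (auto simp: path_act_def G_space_def restrict_def)
  qed
qed

theorem G_fibration_lifting:
  fixes X :: "'x topology" and E :: "'e topology" and B :: "'b topology"
  assumes G: "topological_group G T"
    and E: "G_space G T E a" and B: "G_space G T B b" and X: "G_space G T X c"
    and p: "G_fibration G T E a B b p"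
  shows "G_lifting G X c E a B b p"
  unfolding G_lifting_def
proof (intro allI impI, elim conjE)
  fix f h
  assume f: "G_map G X c E a f"
    and h: "continuous_map (prod_topology (top_of_set {0..1::real}) X) B h"
    and he: "\<forall>t\<in>{0..1}. equivariant G X c b (\<lambda>x. h (t, x))"
    and h0: "\<forall>x\<in>topspace X. h (0, x) = p (f x)"
  let ?I = "top_of_set {0..1::real}"
  define S where "S = {(e, \<gamma>). e \<in> topspace E \<and> \<gamma> \<in> paths B \<and> p e = \<gamma> 0}"
  define U where "U = subtopology (prod_topology E (path_space B)) S"
  let ?d = "diag_act a (path_act b)"
  have tU: "topspace U = S" unfolding U_def S_def by auto
  have Pb: "G_space G T (path_space B) (path_act b)" by (rule G_space_path_space[OF G B])
  have carr: "topspace T = carrier G" using G by (simp add: topological_group_def)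
  have Em: "a g e \<in> topspace E" if "g \<in> carrier G" "e \<in> topspace E" for g e
    using G_space_closed[OF G E] that by simp
  have Pm: "path_act b g \<gamma> \<in> paths B" if "g \<in> carrier G" "\<gamma> \<in> paths B" for g \<gamma>
    using G_space_closed[OF G Pb] that by simp
  have pm: "G_map G E a B b p" using p by (simp add: G_fibration_def)
  have inv: "?d g z \<in> S" if "g \<in> carrier G" "z \<in> S" for g z
    using that Em Pm pm
    by (auto simp: S_def diag_act_def path_act_def G_map_def equivariant_def)
  have Uf: "continuous_map U E fst" and Us: "continuous_map U (path_space B) snd"
    unfolding U_def
    by (auto intro: continuous_map_from_subtopology continuous_map_fst continuous_map_snd)
  have c1: "continuous_map (prod_topology T U) E (\<lambda>z. (\<lambda>(g, x). a g x) (fst z, fst (snd z)))"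
  proof (rule continuous_map_compose[where g = "\<lambda>(g, x). a g x", unfolded o_def])
    show "continuous_map (prod_topology T E) E (\<lambda>(g, x). a g x)" using E by (simp add: G_space_def)
    show "continuous_map (prod_topology T U) (prod_topology T E) (\<lambda>z. (fst z, fst (snd z)))"
      by (intro continuous_map_pairedI continuous_map_fst
          continuous_map_snd [THEN continuous_map_compose, unfolded o_def] Uf Us)
  qed
  have c2: "continuous_map (prod_topology T U) (path_space B)
      (\<lambda>z. (\<lambda>(g, x). path_act b g x) (fst z, snd (snd z)))"
  proof (rule continuous_map_compose[where g = "\<lambda>(g, x). path_act b g x", unfolded o_def])
    show "continuous_map (prod_topology T (path_space B)) (path_space B) (\<lambda>(g, x). path_act b g x)"
      using Pb by (simp add: G_space_def)
    show "continuous_map (prod_topology T U) (prod_topology T (path_space B)) (\<lambda>z. (fst z, snd (snd z)))"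
      by (intro continuous_map_pairedI continuous_map_fst
          continuous_map_snd [THEN continuous_map_compose, unfolded o_def] Uf Us)
  qed
  have "continuous_map (prod_topology T U) (prod_topology E (path_space B)) (\<lambda>(g, z). ?d g z)"
    using continuous_map_pairedI[OF c1 c2]
    by (simp add: diag_act_def case_prod_unfold)
  then have cU: "continuous_map (prod_topology T U) U (\<lambda>(g, z). ?d g z)"
    using inv tU carr by (subst (2) U_def) (auto simp: continuous_map_in_subtopology)
  have GU: "G_space G T U ?d"
    unfolding G_space_def
  proof (intro conjI cU ballI)
    fix z assume z: "z \<in> topspace U"
    then show "?d \<one>\<^bsub>G\<^esub> z = z"
      using E Pb unfolding tU by (auto simp: S_def diag_act_def G_space_def)
    fix g h assume "g \<in> carrier G" "h \<in> carrier G"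
    then show "?d (g \<otimes>\<^bsub>G\<^esub> h) z = ?d g (?d h z)"
      using z E Pb unfolding tU by (auto simp: S_def diag_act_def G_space_def)
  qed
  have L: "G_lifting G U ?d E a B b p" using p GU by (simp add: G_fibration_def)
  have fst_map: "G_map G U ?d E a fst"
    using Uf by (auto simp: G_map_def equivariant_def diag_act_def)
  have "continuous_map (prod_topology ?I U) B (\<lambda>z. (\<lambda>(t, \<gamma>). \<gamma> t) (fst z, snd (snd z)))"
  proof (rule continuous_map_compose[where g = "\<lambda>(t, \<gamma>). \<gamma> t", OF _ path_eval_continuous, unfolded o_def])
    show "continuous_map (prod_topology ?I U) (prod_topology ?I (path_space B)) (\<lambda>z. (fst z, snd (snd z)))"
      by (intro continuous_map_pairedI continuous_map_fst
          continuous_map_snd [THEN continuous_map_compose, unfolded o_def] Uf Us)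
  qed
  then have evU: "continuous_map (prod_topology ?I U) B (\<lambda>(t, e, \<gamma>). \<gamma> t)"
    by (simp add: case_prod_unfold)
  have "\<exists>k. continuous_map (prod_topology ?I U) E k \<and>
             (\<forall>t\<in>{0..1}. equivariant G U ?d a (\<lambda>x. k (t, x))) \<and>
             (\<forall>x\<in>topspace U. k (0, x) = fst x) \<and>
             (\<forall>t\<in>{0..1}. \<forall>x\<in>topspace U. p (k (t, x)) = (\<lambda>(t, e, \<gamma>). \<gamma> t) (t, x))"
    by (rule L[unfolded G_lifting_def, rule_format])
      (use fst_map evU in \<open>auto simp: tU S_def equivariant_def diag_act_def path_act_def\<close>)
  then obtain k where k: "continuous_map (prod_topology ?I U) E k"
      "\<And>t. t \<in> {0..1} \<Longrightarrow> equivariant G U ?d a (\<lambda>x. k (t, x))"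
      "\<And>x. x \<in> topspace U \<Longrightarrow> k (0, x) = fst x"
      "\<And>t e \<gamma>. t \<in> {0..1} \<Longrightarrow> (e, \<gamma>) \<in> topspace U \<Longrightarrow> p (k (t, (e, \<gamma>))) = \<gamma> t"
    by force
  define r where "r = (\<lambda>x. (f x, restrict (\<lambda>t. h (t, x)) {0..1}))"
  have fc: "continuous_map X E f" and fe: "equivariant G X c a f" using f by (auto simp: G_map_def)
  have cc: "continuous_map X (path_space B) (\<lambda>x. restrict (\<lambda>t. h (t, x)) {0..1})"
    by (rule path_curry_continuous[OF h])
  have rS: "r x \<in> S" if "x \<in> topspace X" for x
    using that fc cc h0 unfolding r_def S_def continuous_map_def by auto
  have rc: "continuous_map X U r"
    unfolding U_def continuous_map_in_subtopology
    using continuous_map_pairedI[OF fc cc] rS by (auto simp: r_def)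
  have re: "r (c g x) = ?d g (r x)" if "g \<in> carrier G" "x \<in> topspace X" for g x
    using that fe he
    by (auto simp: r_def diag_act_def path_act_def equivariant_def restrict_def)
  show "\<exists>k. continuous_map (prod_topology ?I X) E k \<and>
             (\<forall>t\<in>{0..1}. equivariant G X c a (\<lambda>x. k (t, x))) \<and>
             (\<forall>x\<in>topspace X. k (0, x) = f x) \<and>
             (\<forall>t\<in>{0..1}. \<forall>x\<in>topspace X. p (k (t, x)) = h (t, x))"
  proof (intro exI[of _ "\<lambda>z. k (fst z, r (snd z))"] conjI ballI)
    have "continuous_map (prod_topology ?I X) (prod_topology ?I U) (\<lambda>z. (fst z, r (snd z)))"
      by (intro continuous_map_pairedI continuous_map_fst
          continuous_map_snd [THEN continuous_map_compose, unfolded o_def] rc)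
    then show "continuous_map (prod_topology ?I X) E (\<lambda>z. k (fst z, r (snd z)))"
      by (rule continuous_map_compose[OF _ k(1), unfolded o_def])
  next
    fix t :: real assume t: "t \<in> {0..1}"
    show "equivariant G X c a (\<lambda>x. k (fst (t, x), r (snd (t, x))))"
      using k(2)[OF t] rS tU re by (simp add: equivariant_def)
    fix x assume x: "x \<in> topspace X"
    show "p (k (fst (t, x), r (snd (t, x)))) = h (t, x)"
      using k(4)[OF t] rS[OF x] tU t by (simp add: r_def)
  next
    fix x assume x: "x \<in> topspace X"
    show "k (fst (0, x), r (snd (0, x))) = f x"
      using k(3) rS[OF x] tU by (simp add: r_def)
  qed
qed


section \<open>Sectional category, LS category and topological complexity\<close>

text \<open>All three invariants are normalised (covers have \<open>n + 1\<close> members) and take values in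
  \<^typ>\<open>enat\<close>; \<open>Inf {} = \<infinity>\<close> covers the case that no cover exists, and otherwise the infimum is
  attained.\<close>

definition secat_G ::
  "('g, 'm) monoid_scheme \<Rightarrow> 'a topology \<Rightarrow> ('g, 'a) act \<Rightarrow> 'c topology \<Rightarrow> ('g, 'c) act
    \<Rightarrow> ('a \<Rightarrow> 'c) \<Rightarrow> enat" where
  "secat_G G A a C c q = Inf {enat n | n.
     \<exists>U :: nat \<Rightarrow> 'c set. (\<Union>i\<le>n. U i) = topspace C \<and>
       (\<forall>i\<le>n. openin C (U i) \<and> G_invariant G c (U i) \<and>
          (\<exists>s. G_map G (subtopology C (U i)) c A a s \<and>
               G_homotopic G (subtopology C (U i)) c C c (\<lambda>x. q (s x)) (\<lambda>x. x)))}"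

definition G_categorical ::
  "('g, 'm) monoid_scheme \<Rightarrow> 'a topology \<Rightarrow> ('g, 'a) act \<Rightarrow> 'a set \<Rightarrow> bool" where
  "G_categorical G X a U \<longleftrightarrow>
     openin X U \<and> G_invariant G a U \<and>
     (\<exists>f. \<exists>x\<in>topspace X. G_map G (subtopology X U) a X a f \<and> f ` U \<subseteq> G_orbit G a x \<and>
        G_homotopic G (subtopology X U) a X a (\<lambda>y. y) f)"

definition cat_G ::
  "('g, 'm) monoid_scheme \<Rightarrow> 'a topology \<Rightarrow> ('g, 'a) act \<Rightarrow> enat" where
  "cat_G G X a = Inf {enat n | n.
     \<exists>U :: nat \<Rightarrow> 'a set. (\<Union>i\<le>n. U i) = topspace X \<and> (\<forall>i\<le>n. G_categorical G X a (U i))}"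

definition TC_G ::
  "('g, 'm) monoid_scheme \<Rightarrow> 'a topology \<Rightarrow> ('g, 'a) act \<Rightarrow> enat" where
  "TC_G G X a =
     secat_G G (path_space X) (path_act a) (prod_topology X X) (diag_act a a) path_ends"

end

theory Submission
  imports Defs
begin

text \<open>
  Let \<open>W\<close> be the preimage under \<open>p \<times> p\<close> of an invariant open set \<open>U \<subseteq> B \<times> B\<close> that contracts
  equivariantly, inside \<open>B \<times> B\<close>, to the fixed point \<open>(b0, b0)\<close>.  The homotopy lifting property of
  \<open>p \<times> p\<close> turns the contraction into an equivariant deformation of \<open>W\<close> inside \<open>E \<times> E\<close> whose final
  stage \<open>\<phi>\<close> lands in \<open>F \<times> F\<close> (\<open>lift_contraction_into_fibre\<close>).  If \<open>V \<subseteq> F \<times> F\<close> carries a homotopy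
  section \<open>s\<close> of the endpoint map of \<open>F\<close>, then \<open>s \<circ> \<phi>\<close>, with paths in \<open>F\<close> read as paths in \<open>E\<close>, is a
  homotopy section over \<open>W \<inter> \<phi>\<^sup>-\<^sup>1 V\<close>: its endpoints are those of \<open>s\<close>, hence homotopic to \<open>\<phi>\<close>, hence
  to the inclusion (\<open>G_sectional_path_ends_pullback\<close>).  A cover of \<open>B \<times> B\<close> by \<open>n + 1\<close> such sets \<open>U\<close>
  and one of \<open>F \<times> F\<close> by \<open>m + 1\<close> such sets \<open>V\<close> give a cover of \<open>E \<times> E\<close> by \<open>(m + 1) (n + 1)\<close> sets,
  which is the inequality.

  A G-categorical set is only known to deform into some orbit \<open>G z\<close>, so it must be shown that it
  deforms further, to \<open>(b0, b0)\<close> (\<open>G_categorical_contractible_to_fixed_point\<close>).  If \<open>H\<close> is the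
  stabilizer of \<open>z\<close>, G-connectedness gives a path \<open>\<delta>\<close> of \<open>H\<close>-fixed points from \<open>z\<close> to \<open>(b0, b0)\<close>, and
  \<open>(t, g z) \<mapsto> g (\<delta> t)\<close> moves the orbit to the fixed point.  This requires that \<open>H\<close> be closed and that
  the formula be continuous on \<open>G z\<close> with its subspace topology, that is, that \<open>g \<mapsto> g z\<close> be a quotient
  map onto the orbit.  In a T0 space acted on by a compact group both are true: compactness makes
  powers of each group element return arbitrarily close to the identity, which makes the
  specialization preorder symmetric on orbits and therefore, by T0, trivial; so the points of an
  orbit are closed in it, and the orbit map is closed.
\<close>

section \<open>Orbits in T0 spaces\<close>

lemma continuous_map_action:
  assumes "G_space G T X a" "continuous_map Z T f" "continuous_map Z X u"
  shows "continuous_map Z X (\<lambda>z. a (f z) (u z))"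
proof -
  have "continuous_map (prod_topology T X) X (\<lambda>(g, x). a g x)"
    using assms(1) by (simp add: G_space_def)
  from continuous_map_compose[OF continuous_map_pairedI[OF assms(2,3)] this]
  show ?thesis by (simp add: o_def)
qed

lemma continuous_map_translation:
  assumes "topological_group G T" "G_space G T X a" "g \<in> carrier G"
  shows "continuous_map X X (a g)"
  using continuous_map_action[OF assms(2), of X "\<lambda>_. g" "\<lambda>x. x"] assms(1,3)
  by (simp add: topological_group_def)

lemma continuous_map_orbit_map:
  assumes "topological_group G T" "G_space G T X a" "x \<in> topspace X"
  shows "continuous_map T X (\<lambda>g. a g x)"
  using continuous_map_action[OF assms(2), of T "\<lambda>g. g" "\<lambda>_. x"] assms(3) by simp

lemma G_space_subtopology:
  assumes G: "topological_group G T" and X: "G_space G T X a" and W: "G_invariant G a W"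
  shows "G_space G T (subtopology X W) a"
proof -
  let ?W = "subtopology X W"
  have "continuous_map (prod_topology T ?W) X (\<lambda>z. a (fst z) (snd z))"
    by (rule continuous_map_action[OF X])
      (auto intro: continuous_map_fst continuous_map_into_fulltopology[OF continuous_map_snd])
  then have "continuous_map (prod_topology T ?W) ?W (\<lambda>(g, y). a g y)"
    using W G by (auto simp: continuous_map_in_subtopology case_prod_unfold G_invariant_def topological_group_def)
  then show ?thesis using X by (simp add: G_space_def)
qed

lemma G_space_inv_cancel:
  assumes "topological_group G T" "G_space G T X a" "g \<in> carrier G" "x \<in> topspace X"
  shows "a (inv\<^bsub>G\<^esub> g) (a g x) = x" "a g (a (inv\<^bsub>G\<^esub> g) x) = x"
proof -
  interpret group G using assms(1) by (simp add: topological_group_def)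
  show "a (inv\<^bsub>G\<^esub> g) (a g x) = x" "a g (a (inv\<^bsub>G\<^esub> g) x) = x"
    using assms(2-4) l_inv[OF assms(3)] r_inv[OF assms(3)] inv_closed[OF assms(3)]
    unfolding G_space_def by metis+
qed

text \<open>
  By compactness finitely many open sets \<open>W\<close> with \<open>u\<^sup>-\<^sup>1 v \<in> V\<close> for all \<open>u, v \<in> W\<close> cover the group.
  Two powers \<open>g^i\<close>, \<open>g^j\<close> with \<open>i < j\<close> lie in the same one, and then \<open>n = j - i\<close> works.
\<close>

lemma compact_group_power_recurrence:
  assumes G: "topological_group G T" and comp: "compact_space T"
    and g: "g \<in> carrier G" and V: "openin T V" "\<one>\<^bsub>G\<^esub> \<in> V"
  obtains n :: nat where "n > 0" "g [^]\<^bsub>G\<^esub> n \<in> V"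
proof -
  interpret group G using G by (simp add: topological_group_def)
  have tT: "topspace T = carrier G" using G by (simp add: topological_group_def)
  define Q where "Q = {z \<in> topspace (prod_topology T T). inv\<^bsub>G\<^esub> fst z \<otimes>\<^bsub>G\<^esub> snd z \<in> V}"
  have mult: "continuous_map (prod_topology T T) T (\<lambda>(x, y). x \<otimes>\<^bsub>G\<^esub> y)"
    and inv: "continuous_map T T (\<lambda>x. inv\<^bsub>G\<^esub> x)" using G by (auto simp: topological_group_def)
  have "continuous_map (prod_topology T T) (prod_topology T T) (\<lambda>z. (inv\<^bsub>G\<^esub> fst z, snd z))"
    by (intro continuous_map_pairedI continuous_map_snd
        continuous_map_compose[OF continuous_map_fst inv, unfolded o_def])
  from continuous_map_compose[OF this mult]
  have "continuous_map (prod_topology T T) T (\<lambda>z. inv\<^bsub>G\<^esub> fst z \<otimes>\<^bsub>G\<^esub> snd z)"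
    by (simp add: o_def)
  then have Q: "openin (prod_topology T T) Q"
    unfolding Q_def using V(1) by (rule openin_continuous_map_preimage)
  define \<W> where "\<W> = {W. openin T W \<and> W \<times> W \<subseteq> Q}"
  have "topspace T \<subseteq> \<Union>\<W>"
  proof
    fix h assume h: "h \<in> topspace T"
    then have hQ: "(h, h) \<in> Q" using V tT by (simp add: Q_def)
    obtain A A' where "openin T A" "openin T A'" "h \<in> A" "h \<in> A'" "A \<times> A' \<subseteq> Q"
      using Q[unfolded openin_prod_topology_alt, rule_format, OF hQ] by metis
    then have "A \<inter> A' \<in> \<W>" "h \<in> A \<inter> A'" unfolding \<W>_def by blast+
    then show "h \<in> \<Union>\<W>" by blast
  qed
  then obtain \<F> where \<F>: "finite \<F>" "\<F> \<subseteq> \<W>" "topspace T \<subseteq> \<Union>\<F>"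
    using comp[unfolded compact_space_alt, rule_format, of \<W>] by (auto simp: \<W>_def)
  have "\<forall>n::nat. \<exists>W\<in>\<F>. g [^]\<^bsub>G\<^esub> n \<in> W" using \<F>(3) g tT by (metis UnionE nat_pow_closed subsetD)
  then obtain w where w: "\<And>n::nat. w n \<in> \<F>" "\<And>n::nat. g [^]\<^bsub>G\<^esub> n \<in> w n" by metis
  have "\<not> inj w"
    using w(1) \<F>(1) finite_subset[of "range w" \<F>] finite_imageD[of w UNIV] infinite_UNIV_nat by blast
  then obtain i j where ij: "i < j" "w i = w j"
    unfolding inj_def by (metis linorder_neqE_nat)
  have "(g [^]\<^bsub>G\<^esub> i, g [^]\<^bsub>G\<^esub> j) \<in> Q"
    using w(1)[of i] w(2)[of i] w(2)[of j] ij \<F>(2) by (auto simp: \<W>_def)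
  moreover have "g [^]\<^bsub>G\<^esub> j = g [^]\<^bsub>G\<^esub> i \<otimes>\<^bsub>G\<^esub> g [^]\<^bsub>G\<^esub> (j - i)"
    using g ij nat_pow_mult[of g i "j - i"] by simp
  then have "inv\<^bsub>G\<^esub> (g [^]\<^bsub>G\<^esub> i) \<otimes>\<^bsub>G\<^esub> g [^]\<^bsub>G\<^esub> j = g [^]\<^bsub>G\<^esub> (j - i)"
    using g by (simp add: m_assoc[symmetric])
  ultimately have "g [^]\<^bsub>G\<^esub> (j - i) \<in> V" by (simp add: Q_def)
  then show ?thesis using that[of "j - i"] ij by simp
qed

text \<open>
  Write \<open>x \<le> y\<close> if every open set containing \<open>x\<close> contains \<open>y\<close>.  Translations preserve this preorder,
  so \<open>x \<le> g x\<close> gives \<open>g^(- m) x \<le> x\<close> for all \<open>m \<ge> 0\<close>.  If \<open>g x \<in> U\<close>, recurrence yields \<open>n > 0\<close> with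
  \<open>g^(- n)\<close> so close to the identity that \<open>g^(- n) (g x) = g^(- (n - 1)) x\<close> is still in \<open>U\<close>; hence
  \<open>x \<in> U\<close>, and so \<open>g x \<le> x\<close>.
\<close>

lemma orbit_specialization_symmetric:
  assumes G: "topological_group G T" and comp: "compact_space T" and X: "G_space G T X a"
    and g: "g \<in> carrier G" and x: "x \<in> topspace X"
    and le: "\<And>U. openin X U \<Longrightarrow> x \<in> U \<Longrightarrow> a g x \<in> U"
    and U: "openin X U" "a g x \<in> U"
  shows "x \<in> U"
proof -
  interpret group G using G by (simp add: topological_group_def)
  have tT: "topspace T = carrier G" using G by (simp add: topological_group_def)
  let ?h = "inv\<^bsub>G\<^esub> g"
  have h: "?h \<in> carrier G" using g by simp
  note closed = G_space_closed[OF G X]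
  have pull: "openin X {y \<in> topspace X. a k y \<in> W}" if "k \<in> carrier G" "openin X W" for k W
    using openin_continuous_map_preimage[OF continuous_map_translation[OF G X that(1)] that(2)] .
  have act: "a (k \<otimes>\<^bsub>G\<^esub> l) y = a k (a l y)"
    if "k \<in> carrier G" "l \<in> carrier G" "y \<in> topspace X" for k l y
    using X that by (simp add: G_space_def)
  have down: "x \<in> W" if "openin X W" "a (?h [^]\<^bsub>G\<^esub> n) x \<in> W" for n :: nat and W
    using that
  proof (induction n arbitrary: W)
    case 0
    then show ?case using X x by (simp add: G_space_def)
  next
    case (Suc n)
    have "a (?h [^]\<^bsub>G\<^esub> Suc n) x = a ?h (a (?h [^]\<^bsub>G\<^esub> n) x)"
      using act[of ?h "?h [^]\<^bsub>G\<^esub> n" x] nat_pow_Suc2[OF h, of n] h x by simp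
    then have "x \<in> {y \<in> topspace X. a ?h y \<in> W}"
      using Suc.prems Suc.IH[OF pull[OF h Suc.prems(1)]] closed h x by simp
    then have "a g x \<in> {y \<in> topspace X. a ?h y \<in> W}"
      using le pull[OF h Suc.prems(1)] by blast
    then show ?case using G_space_inv_cancel[OF G X g x] by simp
  qed
  define V where "V = {k \<in> topspace T. a k (a g x) \<in> U}"
  have "openin T V"
    unfolding V_def
    by (rule openin_continuous_map_preimage[OF continuous_map_orbit_map[OF G X closed[OF g x]] U(1)])
  moreover have "\<one>\<^bsub>G\<^esub> \<in> V" using X U(2) closed[OF g x] tT by (simp add: V_def G_space_def)
  ultimately obtain n :: nat where n: "n > 0" "?h [^]\<^bsub>G\<^esub> n \<in> V"
    using compact_group_power_recurrence[OF G comp h] by blast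
  then obtain m where m: "n = Suc m" by (cases n) auto
  have "a (?h [^]\<^bsub>G\<^esub> n) (a g x) = a (?h [^]\<^bsub>G\<^esub> m) x"
    using act[of "?h [^]\<^bsub>G\<^esub> m" ?h "a g x"] h closed[OF g x] G_space_inv_cancel[OF G X g x]
    by (simp add: m)
  then show ?thesis using n(2) down[OF U(1), of m] by (simp add: V_def)
qed

lemma G_orbit_subset:
  assumes "topological_group G T" "G_space G T X a" "x \<in> topspace X"
  shows "G_orbit G a x \<subseteq> topspace X"
  using G_space_closed[OF assms(1,2)] assms(3) by (auto simp: G_orbit_def)

text \<open>
  A point \<open>w \<noteq> x\<close> of the orbit that could not be separated from \<open>x\<close> by an open set around \<open>w\<close> would,
  by the symmetry just shown, be topologically indistinguishable from \<open>x\<close>.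
\<close>

lemma closedin_singleton_orbit:
  assumes G: "topological_group G T" and comp: "compact_space T" and X: "G_space G T X a"
    and T0: "t0_space X" and x: "x \<in> topspace X"
  shows "closedin (subtopology X (G_orbit G a x)) {x}"
proof -
  interpret group G using G by (simp add: topological_group_def)
  let ?Y = "subtopology X (G_orbit G a x)"
  have tY: "topspace ?Y = G_orbit G a x" using G_orbit_subset[OF G X x] by (simp add: inf_absorb2)
  have "a \<one>\<^bsub>G\<^esub> x = x" using X x by (simp add: G_space_def)
  then have xY: "x \<in> G_orbit G a x"
    unfolding G_orbit_def by (intro CollectI exI[of _ "\<one>\<^bsub>G\<^esub>"]) simp
  have "\<exists>U. openin X U \<and> w \<in> U \<and> x \<notin> U" if w: "w \<in> G_orbit G a x" "w \<noteq> x" for w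
  proof (rule ccontr)
    assume no: "\<nexists>U. openin X U \<and> w \<in> U \<and> x \<notin> U"
    obtain g where g: "g \<in> carrier G" "w = a g x" using w by (auto simp: G_orbit_def)
    have wX: "w \<in> topspace X" using G_space_closed[OF G X g(1) x] g by simp
    have xw: "x = a (inv\<^bsub>G\<^esub> g) w" using G_space_inv_cancel[OF G X g(1) x] g by simp
    have "w \<in> U" if "openin X U" "x \<in> U" for U
      by (rule orbit_specialization_symmetric[OF G comp X inv_closed[OF g(1)] wX _ that(1)])
        (use no xw that in auto)
    then show False using T0 no w x wX unfolding t0_space_def by metis
  qed
  then have sep: "\<And>w. w \<in> G_orbit G a x - {x} \<Longrightarrow> \<exists>U. openin X U \<and> w \<in> U \<and> x \<notin> U"
    by blast
  have "openin ?Y (topspace ?Y - {x})"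
    unfolding tY
  proof (subst openin_subopen, intro ballI)
    fix w assume w: "w \<in> G_orbit G a x - {x}"
    then obtain U where "openin X U" "w \<in> U" "x \<notin> U" using sep by blast
    then show "\<exists>N. openin ?Y N \<and> w \<in> N \<and> N \<subseteq> G_orbit G a x - {x}"
      using w by (intro exI[of _ "U \<inter> G_orbit G a x"]) (auto simp: openin_subtopology)
  qed
  then show ?thesis using xY tY by (simp add: closedin_def)
qed

lemma G_invariant_orbit:
  assumes G: "topological_group G T" and X: "G_space G T X a" and x: "x \<in> topspace X"
  shows "G_invariant G a (G_orbit G a x)"
  unfolding G_invariant_def
proof (intro ballI)
  interpret group G using G by (simp add: topological_group_def)
  fix g y assume g: "g \<in> carrier G" and y: "y \<in> G_orbit G a x"
  obtain h where h: "h \<in> carrier G" "y = a h x" using y by (auto simp: G_orbit_def)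
  then have "a g y = a (g \<otimes>\<^bsub>G\<^esub> h) x" using X g x by (simp add: G_space_def)
  then show "a g y \<in> G_orbit G a x" using g h by (auto simp: G_orbit_def)
qed

text \<open>
  The graph of the orbit map is the preimage of the closed point \<open>x\<close> under \<open>(g, y) \<mapsto> g\<^sup>-\<^sup>1 y\<close>, hence
  closed; and projecting along a compact factor is a closed map.
\<close>

lemma closed_map_orbit_map:
  assumes G: "topological_group G T" and comp: "compact_space T" and X: "G_space G T X a"
    and T0: "t0_space X" and x: "x \<in> topspace X"
  shows "closed_map T (subtopology X (G_orbit G a x)) (\<lambda>g. a g x)"
  unfolding closed_map_def
proof (intro allI impI)
  fix C assume C: "closedin T C"
  let ?Y = "subtopology X (G_orbit G a x)"
  interpret group G using G by (simp add: topological_group_def)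
  have tT: "topspace T = carrier G" using G by (simp add: topological_group_def)
  have tY: "topspace ?Y = G_orbit G a x" using G_orbit_subset[OF G X x] by (simp add: inf_absorb2)
  define P where "P = {z \<in> topspace (prod_topology T ?Y). a (inv\<^bsub>G\<^esub> fst z) (snd z) \<in> {x}}"
  have "continuous_map (prod_topology T ?Y) ?Y (\<lambda>z. a (inv\<^bsub>G\<^esub> fst z) (snd z))"
    using G by (intro continuous_map_action[OF G_space_subtopology[OF G X G_invariant_orbit[OF G X x]]] continuous_map_snd
        continuous_map_compose[OF continuous_map_fst, unfolded o_def])
      (simp add: topological_group_def)
  then have P: "closedin (prod_topology T ?Y) P"
    unfolding P_def
    by (rule closedin_continuous_map_preimage) (rule closedin_singleton_orbit[OF G comp X T0 x])
  have "closedin (prod_topology T ?Y) (P \<inter> (C \<times> topspace ?Y))"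
    using C P by (intro closedin_Int) (simp_all add: closedin_prod_Times_iff del: topspace_subtopology)
  then have "closedin ?Y (snd ` (P \<inter> (C \<times> topspace ?Y)))"
    using Abstract_Topological_Spaces.closed_map_snd[OF comp, of ?Y] by (simp add: closed_map_def)
  moreover have "snd ` (P \<inter> (C \<times> topspace ?Y)) = (\<lambda>g. a g x) ` C"
  proof
    show "snd ` (P \<inter> (C \<times> topspace ?Y)) \<subseteq> (\<lambda>g. a g x) ` C"
    proof clarify
      fix g y assume "(g, y) \<in> P" "g \<in> C"
      then have "g \<in> carrier G" "y \<in> topspace X" "a (inv\<^bsub>G\<^esub> g) y = x"
        by (auto simp: P_def tT)
      then have "y = a g x" using G_space_inv_cancel[OF G X] by metis
      then show "snd (g, y) \<in> (\<lambda>g. a g x) ` C" using \<open>g \<in> C\<close> by auto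
    qed
    show "(\<lambda>g. a g x) ` C \<subseteq> snd ` (P \<inter> (C \<times> topspace ?Y))"
    proof clarify
      fix g assume g: "g \<in> C"
      then have gG: "g \<in> carrier G" using closedin_subset[OF C] tT by auto
      then have o: "a g x \<in> G_orbit G a x" by (auto simp: G_orbit_def)
      then have "(g, a g x) \<in> P"
        using gG G_space_inv_cancel[OF G X gG x] by (simp add: P_def tT tY del: topspace_subtopology)
      then have "(g, a g x) \<in> P \<inter> (C \<times> topspace ?Y)" using g o tY by auto
      then show "a g x \<in> snd ` (P \<inter> (C \<times> topspace ?Y))" by (metis image_eqI snd_conv)
    qed
  qed
  ultimately show "closedin ?Y ((\<lambda>g. a g x) ` C)" by simp
qed

lemma quotient_map_orbit_map:
  assumes G: "topological_group G T" and comp: "compact_space T" and X: "G_space G T X a"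
    and T0: "t0_space X" and x: "x \<in> topspace X"
  shows "quotient_map T (subtopology X (G_orbit G a x)) (\<lambda>g. a g x)"
proof (rule continuous_closed_imp_quotient_map)
  have tT: "topspace T = carrier G" using G by (simp add: topological_group_def)
  show "continuous_map T (subtopology X (G_orbit G a x)) (\<lambda>g. a g x)"
    using continuous_map_orbit_map[OF G X x] tT
    by (auto simp: continuous_map_in_subtopology G_orbit_def)
  show "(\<lambda>g. a g x) ` topspace T = topspace (subtopology X (G_orbit G a x))"
    using G_orbit_subset[OF G X x] tT by (auto simp: G_orbit_def)
qed (rule closed_map_orbit_map[OF assms])


section \<open>Contracting G-categorical sets\<close>

text \<open>
  The homotopy \<open>(t, g z) \<mapsto> g (\<delta> t)\<close>.  Continuity is obtained through the path space: the map
  \<open>g \<mapsto> g \<delta>\<close> from the group to paths is continuous and factors through the orbit map, which is a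
  quotient map; this avoids asking whether its product with the interval is again a quotient map.
\<close>

lemma transport_along_orbit:
  assumes G: "topological_group G T" and comp: "compact_space T" and X: "G_space G T X a"
    and T0: "t0_space X" and z: "z \<in> topspace X" and \<delta>: "pathin X \<delta>"
    and stab: "\<And>g t. g \<in> carrier G \<Longrightarrow> a g z = z \<Longrightarrow> t \<in> {0..1} \<Longrightarrow> a g (\<delta> t) = \<delta> t"
  obtains k where
    "continuous_map (prod_topology (top_of_set {0..1::real}) (subtopology X (G_orbit G a z))) X k"
    "\<And>g t. g \<in> carrier G \<Longrightarrow> t \<in> {0..1} \<Longrightarrow> k (t, a g z) = a g (\<delta> t)"
proof -
  interpret group G using G by (simp add: topological_group_def)
  let ?I = "top_of_set {0..1::real}"
  have \<delta>X: "\<delta> t \<in> topspace X" if "t \<in> {0..1}" for t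
    using \<delta> that by (auto simp: pathin_def continuous_map_def)
  define P where
    "P y = restrict (\<lambda>t. a (SOME g. g \<in> carrier G \<and> a g z = y) (\<delta> t)) {0..1}" for y
  \<comment> \<open>Two group elements with the same value at \<open>z\<close> differ by the stabilizer of \<open>z\<close>, which fixes \<open>\<delta>\<close>.\<close>
  have P: "P (a g z) = restrict (\<lambda>t. a g (\<delta> t)) {0..1}" if g: "g \<in> carrier G" for g
  proof -
    define h where "h = (SOME h. h \<in> carrier G \<and> a h z = a g z)"
    have h: "h \<in> carrier G" "a h z = a g z"
      using someI[of "\<lambda>h. h \<in> carrier G \<and> a h z = a g z" g] g by (auto simp: h_def)
    have act: "a (inv\<^bsub>G\<^esub> g \<otimes>\<^bsub>G\<^esub> h) y = a (inv\<^bsub>G\<^esub> g) (a h y)" if "y \<in> topspace X" for y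
      using X g h that by (simp add: G_space_def)
    have "a (inv\<^bsub>G\<^esub> g \<otimes>\<^bsub>G\<^esub> h) z = z"
      using act[OF z] h G_space_inv_cancel[OF G X g z] by simp
    then have "a (inv\<^bsub>G\<^esub> g) (a h (\<delta> t)) = \<delta> t" if "t \<in> {0..1}" for t
      using stab[of "inv\<^bsub>G\<^esub> g \<otimes>\<^bsub>G\<^esub> h" t] act[OF \<delta>X[OF that]] that g h by simp
    then have "a h (\<delta> t) = a g (\<delta> t)" if "t \<in> {0..1}" for t
      using that G_space_inv_cancel(2)[OF G X g G_space_closed[OF G X h(1) \<delta>X[OF that]]] by simp
    then show ?thesis unfolding P_def h_def[symmetric] by (auto simp: restrict_def)
  qed
  have "continuous_map (prod_topology ?I T) X (\<lambda>z. a (snd z) (\<delta> (fst z)))"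
    using continuous_map_compose[OF continuous_map_fst \<delta>[unfolded pathin_def], of T]
    by (intro continuous_map_action[OF X] continuous_map_snd) (simp add: o_def)
  then have "continuous_map T (path_space X) (\<lambda>g. restrict (\<lambda>t. a (snd (t, g)) (\<delta> (fst (t, g)))) {0..1})"
    by (rule path_curry_continuous)
  then have "continuous_map T (path_space X) (P \<circ> (\<lambda>g. a g z))"
    by (rule continuous_map_eq) (use G P in \<open>simp add: topological_group_def\<close>)
  then have "continuous_map (subtopology X (G_orbit G a z)) (path_space X) P"
    using continuous_compose_quotient_map quotient_map_orbit_map[OF G comp X T0 z] by blast
  from continuous_map_compose[OF continuous_map_snd this]
  have "continuous_map (prod_topology ?I (subtopology X (G_orbit G a z))) (path_space X) (\<lambda>w. P (snd w))"
    by (simp add: o_def)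
  from continuous_map_compose[OF continuous_map_pairedI[OF continuous_map_fst this] path_eval_continuous]
  have "continuous_map (prod_topology ?I (subtopology X (G_orbit G a z))) X (\<lambda>w. P (snd w) (fst w))"
    by (simp add: o_def)
  then show ?thesis using that[of "\<lambda>w. P (snd w) (fst w)"] P by simp
qed

lemma equivariant_cong:
  assumes "G_invariant G c (topspace Z)" "\<And>x. x \<in> topspace Z \<Longrightarrow> h x = k x"
  shows "equivariant G Z c d h \<longleftrightarrow> equivariant G Z c d k"
  using assms by (auto simp: equivariant_def G_invariant_def)

text \<open>
  Homotopies are total functions, so invariance of the domain lets their values off it be adjusted
  without spoiling equivariance.
\<close>

lemma G_homotopicI:
  assumes Z: "G_invariant G c (topspace Z)"
    and "continuous_map (prod_topology (top_of_set {0..1::real}) Z) Y h"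
    and "\<And>t. t \<in> {0..1} \<Longrightarrow> equivariant G Z c d (\<lambda>x. h (t, x))"
    and "\<And>x. x \<in> topspace Z \<Longrightarrow> h (0, x) = f x" "\<And>x. x \<in> topspace Z \<Longrightarrow> h (1, x) = g x"
  shows "G_homotopic G Z c Y d f g"
  unfolding G_homotopic_def
  by (subst homotopic_with[OF equivariant_cong[OF Z]]) (use assms(2-) in blast)+

lemma G_homotopic_imp_G_map:
  assumes "G_homotopic G Z c Y d f g"
  shows "G_map G Z c Y d f" "G_map G Z c Y d g"
  using homotopic_with_imp_continuous_maps homotopic_with_imp_property assms
  unfolding G_homotopic_def G_map_def by blast+

lemma closedin_stabilizer:
  assumes G: "topological_group G T" and comp: "compact_space T" and X: "G_space G T X a"
    and T0: "t0_space X" and z: "z \<in> topspace X"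
  shows "closedin T {g \<in> carrier G. a g z = z}"
proof -
  have "continuous_map T (subtopology X (G_orbit G a z)) (\<lambda>g. a g z)"
    using quotient_map_orbit_map[OF assms] by (rule quotient_imp_continuous_map)
  then have "closedin T {g \<in> topspace T. a g z \<in> {z}}"
    by (rule closedin_continuous_map_preimage[OF _ closedin_singleton_orbit[OF assms]])
  then show ?thesis using G by (simp add: topological_group_def)
qed

lemma subgroup_stabilizer:
  assumes G: "topological_group G T" and X: "G_space G T X a" and z: "z \<in> topspace X"
  shows "subgroup {g \<in> carrier G. a g z = z} G"
proof -
  interpret group G using G by (simp add: topological_group_def)
  show ?thesis
  proof (rule subgroupI)
    have "a \<one>\<^bsub>G\<^esub> z = z" using X z by (simp add: G_space_def)
    then show "{g \<in> carrier G. a g z = z} \<noteq> {}" using one_closed by blast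
    fix g assume g: "g \<in> {g \<in> carrier G. a g z = z}"
    then show "inv\<^bsub>G\<^esub> g \<in> {g \<in> carrier G. a g z = z}"
      using G_space_inv_cancel(1)[OF G X, of g z] z by simp
    fix h assume "h \<in> {g \<in> carrier G. a g z = z}"
    then show "g \<otimes>\<^bsub>G\<^esub> h \<in> {g \<in> carrier G. a g z = z}"
      using X g z by (simp add: G_space_def)
  qed auto
qed

text \<open>
  The stabilizer \<open>H\<close> of the point \<open>z\<close> whose orbit receives \<open>U\<close> is closed, so the \<open>H\<close>-fixed points form
  a path-connected set containing both \<open>z\<close> and \<open>x0\<close>.  A path between them in that set is
  transported along the orbit of \<open>z\<close>; at time 1 it has reached \<open>g x0 = x0\<close> everywhere.
\<close>

lemma G_categorical_contractible_to_fixed_point: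
  assumes G: "topological_group G T" and comp: "compact_space T" and X: "G_space G T X a"
    and T0: "t0_space X" and conn: "G_connected G T X a"
    and x0: "x0 \<in> fixed_points (carrier G) X a" and U: "G_categorical G X a U"
  shows "G_homotopic G (subtopology X U) a X a (\<lambda>x. x) (\<lambda>_. x0)"
proof -
  let ?I = "top_of_set {0..1::real}" and ?U = "subtopology X U"
  have UX: "U \<subseteq> topspace X" and Uinv: "G_invariant G a U"
    using U openin_subset by (auto simp: G_categorical_def)
  have tU: "topspace ?U = U" using UX by (simp add: inf_absorb2)
  obtain f z where z: "z \<in> topspace X" and f: "G_map G ?U a X a f" "f ` U \<subseteq> G_orbit G a z"
    and hom: "G_homotopic G ?U a X a (\<lambda>y. y) f"
    using U unfolding G_categorical_def by blast
  define H where "H = {g \<in> carrier G. a g z = z}"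
  have "path_connectedin X (fixed_points H X a)"
    using conn subgroup_stabilizer[OF G X z] closedin_stabilizer[OF G comp X T0 z]
    by (simp add: G_connected_def H_def)
  moreover have "z \<in> fixed_points H X a" "x0 \<in> fixed_points H X a"
    using z x0 by (auto simp: fixed_points_def H_def)
  ultimately obtain \<delta> where \<delta>: "pathin X \<delta>" "\<delta> \<in> {0..1} \<rightarrow> fixed_points H X a" "\<delta> 0 = z" "\<delta> 1 = x0"
    unfolding path_connectedin by metis
  have \<delta>H: "a g (\<delta> t) = \<delta> t" if "g \<in> carrier G" "a g z = z" "t \<in> {0..1}" for g t
    using \<delta>(2) that unfolding fixed_points_def H_def by blast
  have \<delta>X: "\<delta> t \<in> topspace X" if "t \<in> {0..1}" for t
    using \<delta>(2) that unfolding fixed_points_def by blast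
  obtain k where k: "continuous_map (prod_topology ?I (subtopology X (G_orbit G a z))) X k"
      "\<And>g t. g \<in> carrier G \<Longrightarrow> t \<in> {0..1} \<Longrightarrow> k (t, a g z) = a g (\<delta> t)"
    using transport_along_orbit[OF G comp X T0 z \<delta>(1) \<delta>H] by blast
  have orb: "\<exists>g\<in>carrier G. f u = a g z" if "u \<in> U" for u
    using f(2) that by (force simp: G_orbit_def)
  have act: "a (g \<otimes>\<^bsub>G\<^esub> h) y = a g (a h y)"
    if "g \<in> carrier G" "h \<in> carrier G" "y \<in> topspace X" for g h y
    using X that by (simp add: G_space_def)
  have "G_homotopic G ?U a X a f (\<lambda>_. x0)"
  proof (rule G_homotopicI[where h = "\<lambda>w. k (fst w, f (snd w))"])
    show "G_invariant G a (topspace ?U)" using Uinv tU by simp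
    have "continuous_map ?U (subtopology X (G_orbit G a z)) f"
      using f tU by (auto simp: G_map_def continuous_map_in_subtopology)
    from continuous_map_compose[OF continuous_map_snd this]
    have "continuous_map (prod_topology ?I ?U) (subtopology X (G_orbit G a z)) (\<lambda>w. f (snd w))"
      by (simp add: o_def)
    from continuous_map_compose[OF continuous_map_pairedI[OF continuous_map_fst this] k(1)]
    show "continuous_map (prod_topology ?I ?U) X (\<lambda>w. k (fst w, f (snd w)))" by (simp add: o_def)
  next
    fix t :: real assume t: "t \<in> {0..1}"
    show "equivariant G ?U a a (\<lambda>x. k (fst (t, x), f (snd (t, x))))"
      unfolding equivariant_def
    proof (intro ballI)
      fix g u assume g: "g \<in> carrier G" and u: "u \<in> topspace ?U"
      then obtain h where h: "h \<in> carrier G" "f u = a h z" using orb tU by auto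
      have gh: "g \<otimes>\<^bsub>G\<^esub> h \<in> carrier G"
        using G g h by (simp add: topological_group_def group_def monoid.m_closed)
      have "f (a g u) = a g (f u)" using f g u by (simp add: G_map_def equivariant_def)
      then have "f (a g u) = a (g \<otimes>\<^bsub>G\<^esub> h) z" using act[OF g h(1) z] h by simp
      then show "k (fst (t, a g u), f (snd (t, a g u))) = a g (k (fst (t, u), f (snd (t, u))))"
        using k(2)[OF gh t] k(2)[OF h(1) t] h act[OF g h(1) \<delta>X[OF t]] by simp
    qed
  next
    fix u assume "u \<in> topspace ?U"
    then obtain h where h: "h \<in> carrier G" "f u = a h z" using orb tU by auto
    show "k (fst (0, u), f (snd (0, u))) = f u" using k(2)[OF h(1), of 0] h \<delta> by simp
    show "k (fst (1, u), f (snd (1, u))) = x0"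
      using k(2)[OF h(1), of 1] h \<delta> x0 by (simp add: fixed_points_def)
  qed
  then show ?thesis using hom homotopic_with_trans unfolding G_homotopic_def by blast
qed

section \<open>Products\<close>

lemma G_space_prod:
  assumes X: "G_space G T X a" and Y: "G_space G T Y b"
  shows "G_space G T (prod_topology X Y) (diag_act a b)"
proof -
  let ?Z = "prod_topology T (prod_topology X Y)"
  have "continuous_map ?Z X (\<lambda>w. a (fst w) (fst (snd w)))" "continuous_map ?Z Y (\<lambda>w. b (fst w) (snd (snd w)))"
    by (intro continuous_map_action[OF X] continuous_map_action[OF Y] continuous_map_fst
        continuous_map_compose[OF continuous_map_snd continuous_map_fst, unfolded o_def]
        continuous_map_compose[OF continuous_map_snd continuous_map_snd, unfolded o_def])+
  from continuous_map_pairedI[OF this]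
  have "continuous_map ?Z (prod_topology X Y) (\<lambda>(g, z). diag_act a b g z)"
    by (simp add: diag_act_def case_prod_unfold)
  then show ?thesis using X Y by (auto simp: G_space_def diag_act_def)
qed

lemma fixed_points_prod:
  "fixed_points H (prod_topology X Y) (diag_act a b) = fixed_points H X a \<times> fixed_points H Y b"
  by (auto simp: fixed_points_def diag_act_def)

lemma G_connected_prod:
  assumes "G_connected G T X a" "G_connected G T Y b"
  shows "G_connected G T (prod_topology X Y) (diag_act a b)"
  using assms by (simp add: G_connected_def fixed_points_prod path_connectedin_Times)

lemma G_map_pairD:
  assumes "G_map G Z c (prod_topology X Y) (diag_act a b) f"
  shows "G_map G Z c X a (\<lambda>z. fst (f z))" "G_map G Z c Y b (\<lambda>z. snd (f z))"
proof -
  have "continuous_map Z X (fst \<circ> f)" "continuous_map Z Y (snd \<circ> f)"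
    using assms by (auto simp: G_map_def intro: continuous_map_compose continuous_map_fst continuous_map_snd)
  then show "G_map G Z c X a (\<lambda>z. fst (f z))" "G_map G Z c Y b (\<lambda>z. snd (f z))"
    using assms by (auto simp: G_map_def equivariant_def diag_act_def o_def case_prod_unfold)
qed

lemma G_lifting_prod:
  assumes L: "G_lifting G X c E a B b p" "G_lifting G X c E' a' B' b' p'"
  shows "G_lifting G X c (prod_topology E E') (diag_act a a') (prod_topology B B') (diag_act b b')
           (map_prod p p')"
  unfolding G_lifting_def
proof (intro allI impI, elim conjE)
  fix f h
  let ?IX = "prod_topology (top_of_set {0..1::real}) X"
  assume f: "G_map G X c (prod_topology E E') (diag_act a a') f"
    and h: "continuous_map ?IX (prod_topology B B') h"
    and he: "\<forall>t\<in>{0..1}. equivariant G X c (diag_act b b') (\<lambda>x. h (t, x))"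
    and h0: "\<forall>x\<in>topspace X. h (0, x) = map_prod p p' (f x)"
  have hc: "continuous_map ?IX B (\<lambda>w. fst (h w))" "continuous_map ?IX B' (\<lambda>w. snd (h w))"
    using continuous_map_compose[OF h continuous_map_fst] continuous_map_compose[OF h continuous_map_snd]
    by (auto simp: o_def)
  have he': "equivariant G X c b (\<lambda>x. fst (h (t, x)))" "equivariant G X c b' (\<lambda>x. snd (h (t, x)))"
    if "t \<in> {0..1}" for t
    using he that by (auto simp: equivariant_def diag_act_def case_prod_unfold)
  have h0': "fst (h (0, x)) = p (fst (f x))" "snd (h (0, x)) = p' (snd (f x))" if "x \<in> topspace X" for x
    using h0 that by auto
  obtain k where k: "continuous_map ?IX E k" "\<forall>t\<in>{0..1}. equivariant G X c a (\<lambda>x. k (t, x))"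
      "\<forall>x\<in>topspace X. k (0, x) = fst (f x)"
      "\<forall>t\<in>{0..1}. \<forall>x\<in>topspace X. p (k (t, x)) = fst (h (t, x))"
    using L(1)[unfolded G_lifting_def, rule_format, of "\<lambda>x. fst (f x)" "\<lambda>w. fst (h w)"]
      G_map_pairD(1)[OF f] hc he' h0' by metis
  obtain k' where k': "continuous_map ?IX E' k'" "\<forall>t\<in>{0..1}. equivariant G X c a' (\<lambda>x. k' (t, x))"
      "\<forall>x\<in>topspace X. k' (0, x) = snd (f x)"
      "\<forall>t\<in>{0..1}. \<forall>x\<in>topspace X. p' (k' (t, x)) = snd (h (t, x))"
    using L(2)[unfolded G_lifting_def, rule_format, of "\<lambda>x. snd (f x)" "\<lambda>w. snd (h w)"]
      G_map_pairD(2)[OF f] hc he' h0' by metis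
  show "\<exists>k. continuous_map ?IX (prod_topology E E') k \<and>
          (\<forall>t\<in>{0..1}. equivariant G X c (diag_act a a') (\<lambda>x. k (t, x))) \<and>
          (\<forall>x\<in>topspace X. k (0, x) = f x) \<and>
          (\<forall>t\<in>{0..1}. \<forall>x\<in>topspace X. map_prod p p' (k (t, x)) = h (t, x))"
    using k k'
    by (intro exI[of _ "\<lambda>w. (k w, k' w)"] conjI continuous_map_pairedI)
      (auto simp: equivariant_def diag_act_def)
qed


section \<open>Counting covers by sets with a homotopy section\<close>

text \<open>The requirement that \<^const>\<open>secat_G\<close> puts on each member of a cover.\<close>

definition G_sectional ::
  "('g, 'm) monoid_scheme \<Rightarrow> 'a topology \<Rightarrow> ('g, 'a) act \<Rightarrow> 'c topology \<Rightarrow> ('g, 'c) act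
    \<Rightarrow> ('a \<Rightarrow> 'c) \<Rightarrow> 'c set \<Rightarrow> bool" where
  "G_sectional G A a C c q U \<longleftrightarrow> openin C U \<and> G_invariant G c U \<and>
     (\<exists>s. G_map G (subtopology C U) c A a s \<and>
          G_homotopic G (subtopology C U) c C c (\<lambda>x. q (s x)) (\<lambda>x. x))"

lemma Inf_enat_attained:
  assumes "Inf {enat n | n. P n} = enat m"
  shows "P m"
proof -
  have "{enat n | n. P n} \<noteq> {}" using assms by (metis Inf_empty top_enat_def enat.distinct(1))
  then have "Inf {enat n | n. P n} \<in> {enat n | n. P n}"
    unfolding Inf_enat_def by (auto intro: LeastI)
  then show ?thesis using assms by auto
qed

lemma secat_G_attained:
  assumes "secat_G G A a C c q = enat m"
  obtains U :: "nat \<Rightarrow> 'c set" where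
    "(\<Union>i\<le>m. U i) = topspace C" "\<And>i. i \<le> m \<Longrightarrow> G_sectional G A a C c q (U i)"
  using Inf_enat_attained[OF assms[unfolded secat_G_def]] unfolding G_sectional_def by blast

lemma cat_G_attained:
  assumes "cat_G G X a = enat m"
  obtains U :: "nat \<Rightarrow> 'a set" where
    "(\<Union>i\<le>m. U i) = topspace X" "\<And>i. i \<le> m \<Longrightarrow> G_categorical G X a (U i)"
  using Inf_enat_attained[OF assms[unfolded cat_G_def]] by blast

text \<open>
  Both sides carry the \<open>+ 1\<close> that turns the normalised invariants into numbers of covering sets, so
  that the bound becomes plain counting of index pairs.
\<close>

lemma secat_G_le_double_cover:
  fixes N :: "nat \<Rightarrow> nat \<Rightarrow> 'c set"
  assumes cover: "(\<Union>i\<le>m. \<Union>j\<le>n. N i j) = topspace C"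
    and sect: "\<And>i j. i \<le> m \<Longrightarrow> j \<le> n \<Longrightarrow> G_sectional G A a C c q (N i j)"
  shows "secat_G G A a C c q + 1 \<le> (enat m + 1) * (enat n + 1)"
proof -
  \<comment> \<open>Number the pairs \<open>(i, j)\<close> by \<open>k = i * (n + 1) + j\<close>, with largest index \<open>K\<close>.\<close>
  define K where "K = (m + 1) * (n + 1) - 1"
  have K: "K + 1 = (m + 1) * (n + 1)" by (simp add: K_def)
  define U where "U k = N (k div (n + 1)) (k mod (n + 1))" for k
  have idx: "k div (n + 1) \<le> m" "k mod (n + 1) \<le> n" if "k \<le> K" for k
  proof -
    have "k < (m + 1) * (n + 1)" using that K by linarith
    then have "k div (n + 1) < m + 1" by (rule less_mult_imp_div_less)
    then show "k div (n + 1) \<le> m" by simp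
    have "k mod (n + 1) < n + 1" by (rule mod_less_divisor) simp
    then show "k mod (n + 1) \<le> n" by simp
  qed
  have surj: "\<exists>k\<le>K. U k = N i j" if "i \<le> m" "j \<le> n" for i j
  proof (intro exI conjI)
    have "i * (n + 1) \<le> m * (n + 1)" using that(1) by (rule mult_le_mono1)
    moreover have "(m + 1) * (n + 1) = m * (n + 1) + n + 1" by simp
    ultimately show "i * (n + 1) + j \<le> K" using that(2) K by linarith
    have "(j + i * (n + 1)) div (n + 1) = i" "(j + i * (n + 1)) mod (n + 1) = j"
      using that(2) by (simp_all only: div_mult_self1 mod_mult_self1) simp_all
    then show "U (i * (n + 1) + j) = N i j" unfolding U_def by (simp only: add.commute)
  qed
  have "(\<Union>k\<le>K. U k) = (\<Union>i\<le>m. \<Union>j\<le>n. N i j)"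
  proof (intro equalityI subsetI)
    fix x assume "x \<in> (\<Union>k\<le>K. U k)"
    then show "x \<in> (\<Union>i\<le>m. \<Union>j\<le>n. N i j)" using idx unfolding U_def by blast
  next
    fix x assume "x \<in> (\<Union>i\<le>m. \<Union>j\<le>n. N i j)"
    then obtain i j where "i \<le> m" "j \<le> n" "x \<in> N i j" by blast
    then show "x \<in> (\<Union>k\<le>K. U k)" using surj by blast
  qed
  moreover have "G_sectional G A a C c q (U k)" if "k \<le> K" for k
    using sect idx[OF that] by (simp add: U_def)
  ultimately have "secat_G G A a C c q \<le> enat K"
    unfolding secat_G_def
    by (intro Inf_lower CollectI exI[of _ K] conjI exI[of _ U] refl)
      (use cover in \<open>auto simp: G_sectional_def\<close>)
  then have "secat_G G A a C c q + 1 \<le> enat K + 1" by (rule add_right_mono)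
  also have "\<dots> = enat ((m + 1) * (n + 1))" using K by (simp add: one_enat_def)
  also have "\<dots> = (enat m + 1) * (enat n + 1)" by (simp add: one_enat_def)
  finally show ?thesis .
qed


section \<open>Pushing the total space into the fibre\<close>

text \<open>
  The contraction of \<open>U\<close>, precomposed with \<open>q\<close>, is a homotopy on \<open>W\<close> that starts at \<open>q\<close>; so the
  inclusion of \<open>W\<close> is an admissible initial lift, and the lifted homotopy ends over \<open>c0\<close>.
\<close>

lemma lift_contraction_into_fibre:
  assumes qm: "G_map G D d C c q"
    and D: "G_invariant G d (topspace D)"
    and U: "openin C U" "G_invariant G c U"
    and W: "W = {e \<in> topspace D. q e \<in> U}"
    and lift: "G_lifting G (subtopology D W) d D d C c q"
    and contr: "G_homotopic G (subtopology C U) c C c (\<lambda>x. x) (\<lambda>_. c0)"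
  obtains \<phi> where "openin D W" "G_invariant G d W"
    "G_homotopic G (subtopology D W) d D d (\<lambda>x. x) \<phi>"
    "\<And>e. e \<in> W \<Longrightarrow> \<phi> e \<in> topspace D \<and> q (\<phi> e) = c0"
proof -
  let ?I = "top_of_set {0..1::real}" and ?W = "subtopology D W"
  have qc: "continuous_map D C q" and qe: "\<And>g e. g \<in> carrier G \<Longrightarrow> e \<in> topspace D \<Longrightarrow> q (d g e) = c g (q e)"
    using qm by (auto simp: G_map_def equivariant_def)
  have Wo: "openin D W" unfolding W by (rule openin_continuous_map_preimage[OF qc U(1)])
  have Wi: "G_invariant G d W"
    using D U(2) qe by (auto simp: W G_invariant_def)
  have tW: "topspace ?W = W" using W by auto
  obtain h where h: "continuous_map (prod_topology ?I (subtopology C U)) C h"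
      "\<And>x. h (0, x) = x" "\<And>x. h (1, x) = c0"
      "\<And>t. t \<in> {0..1} \<Longrightarrow> equivariant G (subtopology C U) c c (\<lambda>x. h (t, x))"
    using contr unfolding G_homotopic_def homotopic_with_def by blast
  have qW: "continuous_map ?W (subtopology C U) q"
    using qc W by (auto simp: continuous_map_in_subtopology continuous_map_from_subtopology)
  have UC: "topspace (subtopology C U) = U" using openin_subset[OF U(1)] by (simp add: inf_absorb2)
  from continuous_map_compose[OF continuous_map_snd qW]
  have "continuous_map (prod_topology ?I ?W) (subtopology C U) (\<lambda>w. q (snd w))" by (simp add: o_def)
  from continuous_map_compose[OF continuous_map_pairedI[OF continuous_map_fst this] h(1)]
  have hq: "continuous_map (prod_topology ?I ?W) C (\<lambda>w. h (fst w, q (snd w)))" by (simp add: o_def)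
  have hqe: "equivariant G ?W d c (\<lambda>e. h (fst (t, e), q (snd (t, e))))" if "t \<in> {0..1}" for t
    using h(4)[OF that] qe W unfolding equivariant_def tW UC by auto
  have id: "G_map G ?W d D d (\<lambda>x. x)"
    by (auto simp: G_map_def equivariant_def continuous_map_from_subtopology)
  obtain k where k: "continuous_map (prod_topology ?I ?W) D k"
      "\<And>t. t \<in> {0..1} \<Longrightarrow> equivariant G ?W d d (\<lambda>x. k (t, x))"
      "\<And>x. x \<in> W \<Longrightarrow> k (0, x) = x"
      "\<And>t x. t \<in> {0..1} \<Longrightarrow> x \<in> W \<Longrightarrow> q (k (t, x)) = h (t, q x)"
    using lift[unfolded G_lifting_def tW, rule_format, of "\<lambda>x. x" "\<lambda>w. h (fst w, q (snd w))"]
      id hq hqe h(2) by auto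
  show ?thesis
  proof (rule that[OF Wo Wi])
    show "G_homotopic G ?W d D d (\<lambda>x. x) (\<lambda>x. k (1, x))"
      by (rule G_homotopicI[OF _ k(1)]) (use Wi k tW in auto)
    fix e assume e: "e \<in> W"
    have "(1, e) \<in> topspace (prod_topology ?I ?W)" using e tW by simp
    then have "k (1, e) \<in> topspace D" using k(1) by (auto simp: continuous_map_def)
    then show "k (1, e) \<in> topspace D \<and> q (k (1, e)) = c0" using k(4)[of 1 e] e h(3) by simp
  qed
qed

lemma continuous_map_path_space_subtopology:
  "continuous_map (path_space (subtopology X S)) (path_space X) (\<lambda>\<gamma>. \<gamma>)"
proof -
  have "continuous_map (prod_topology (top_of_set {0..1::real}) (path_space (subtopology X S))) X
      (\<lambda>(t, \<gamma>). \<gamma> t)"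
    by (rule continuous_map_into_fulltopology[OF path_eval_continuous])
  then have "continuous_map (path_space (subtopology X S)) (path_space X)
      (\<lambda>\<gamma>. restrict (\<lambda>t. (\<lambda>(t, \<gamma>). \<gamma> t) (t, \<gamma>)) {0..1})"
    by (rule path_curry_continuous)
  then show ?thesis
    by (rule continuous_map_eq) (simp add: paths_def extensional_restrict)
qed

text \<open>
  The section is \<open>s \<circ> \<phi>\<close>.  A homotopy from its endpoints to the inclusion runs in two stages: first
  the homotopy belonging to \<open>s\<close>, precomposed with \<open>\<phi>\<close>, from the endpoints to \<open>\<phi>\<close> inside \<open>F \<times> F\<close>;
  then the reversed deformation of \<open>W\<close>, from \<open>\<phi>\<close> to the inclusion inside \<open>E \<times> E\<close>.
\<close>

lemma G_sectional_path_ends_pullback: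
  assumes F: "F = subtopology E S"
    and W: "openin (prod_topology E E) W" "G_invariant G (diag_act a a) W"
    and \<phi>F: "\<And>e. e \<in> W \<Longrightarrow> \<phi> e \<in> topspace (prod_topology F F)"
    and \<phi>: "G_homotopic G (subtopology (prod_topology E E) W) (diag_act a a)
              (prod_topology E E) (diag_act a a) (\<lambda>x. x) \<phi>"
    and V: "G_sectional G (path_space F) (path_act a) (prod_topology F F) (diag_act a a) path_ends V"
  shows "G_sectional G (path_space E) (path_act a) (prod_topology E E) (diag_act a a) path_ends
           {e \<in> W. \<phi> e \<in> V}"
proof -
  let ?d = "diag_act a a" and ?E = "prod_topology E E" and ?F = "prod_topology F F"
  define N where "N = {e \<in> W. \<phi> e \<in> V}"
  let ?N = "subtopology ?E N"
  obtain s where Vo: "openin ?F V" and Vi: "G_invariant G ?d V"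
    and s: "G_map G (subtopology ?F V) ?d (path_space F) (path_act a) s"
    and sh: "G_homotopic G (subtopology ?F V) ?d ?F ?d (\<lambda>x. path_ends (s x)) (\<lambda>x. x)"
    using V unfolding G_sectional_def by blast
  have tW: "topspace (subtopology ?E W) = W" using openin_subset[OF W(1)] by (simp add: inf_absorb2)
  have tV: "topspace (subtopology ?F V) = V" using openin_subset[OF Vo] by (simp add: inf_absorb2)
  have NW: "N \<subseteq> W" by (auto simp: N_def)
  then have tN: "topspace ?N = N" using tW openin_subset[OF W(1)] by (simp add: inf_absorb2)
  have FE: "?F = subtopology ?E (S \<times> S)" by (simp add: F subtopology_Times)
  have \<phi>m: "G_map G (subtopology ?E W) ?d ?E ?d \<phi>" using G_homotopic_imp_G_map(2)[OF \<phi>] .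
  have \<phi>c: "continuous_map (subtopology ?E W) ?F \<phi>"
    using \<phi>m \<phi>F tW unfolding FE by (auto simp: G_map_def continuous_map_in_subtopology)
  have \<phi>e: "\<phi> (?d g e) = ?d g (\<phi> e)" if "g \<in> carrier G" "e \<in> W" for g e
    using \<phi>m that tW by (simp add: G_map_def equivariant_def)
  have "openin (subtopology ?E W) {e \<in> topspace (subtopology ?E W). \<phi> e \<in> V}"
    by (rule openin_continuous_map_preimage[OF \<phi>c Vo])
  then have "openin (subtopology ?E W) N" unfolding tW N_def .
  then have No: "openin ?E N" using W(1) openin_open_subtopology by blast
  have Ni: "G_invariant G ?d N" using W(2) Vi \<phi>e by (auto simp: N_def G_invariant_def)
  have sub: "subtopology (subtopology ?E W) N = ?N"
    using NW by (simp add: subtopology_subtopology inf_absorb2)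
  have "continuous_map ?N ?F \<phi>"
    using continuous_map_from_subtopology[OF \<phi>c, of N] unfolding sub .
  moreover have "\<phi> \<in> topspace ?N \<rightarrow> V" unfolding tN by (simp add: N_def)
  ultimately have \<phi>N: "continuous_map ?N (subtopology ?F V) \<phi>"
    by (simp only: continuous_map_in_subtopology)
  have incl: "continuous_map ?F ?E (\<lambda>x. x)" unfolding FE by (simp add: continuous_map_from_subtopology)
  have sc: "continuous_map (subtopology ?F V) (path_space F) s"
    and se: "\<And>g x. g \<in> carrier G \<Longrightarrow> x \<in> V \<Longrightarrow> s (?d g x) = path_act a g (s x)"
    using s tV by (auto simp: G_map_def equivariant_def)
  have "continuous_map ?N (path_space F) (s \<circ> \<phi>)" by (rule continuous_map_compose[OF \<phi>N sc])
  from continuous_map_compose[OF this[unfolded F] continuous_map_path_space_subtopology]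
  have "continuous_map ?N (path_space E) (\<lambda>e. s (\<phi> e))" by (simp add: o_def)
  moreover have "equivariant G ?N ?d (path_act a) (\<lambda>e. s (\<phi> e))"
    using se \<phi>e tN by (auto simp: equivariant_def N_def)
  ultimately have \<sigma>: "G_map G ?N ?d (path_space E) (path_act a) (\<lambda>e. s (\<phi> e))"
    by (simp add: G_map_def)
  have "homotopic_with (equivariant G ?N ?d ?d) ?N ?F ((\<lambda>x. path_ends (s x)) \<circ> \<phi>) ((\<lambda>x. x) \<circ> \<phi>)"
    by (rule homotopic_with_compose_continuous_map_right[OF sh[unfolded G_homotopic_def] \<phi>N])
      (use \<phi>e tN tV in \<open>auto simp: equivariant_def N_def\<close>)
  from homotopic_with_compose_continuous_map_left[OF this incl, of "equivariant G ?N ?d ?d"]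
  have 1: "homotopic_with (equivariant G ?N ?d ?d) ?N ?E (\<lambda>e. path_ends (s (\<phi> e))) \<phi>"
    by (simp add: o_def)
  have "homotopic_with (equivariant G (subtopology ?E W) ?d ?d) ?N ?E (\<lambda>x. x) \<phi>"
    using homotopic_from_subtopology[OF \<phi>[unfolded G_homotopic_def], of N] by (simp only: sub)
  then have "homotopic_with (equivariant G ?N ?d ?d) ?N ?E (\<lambda>x. x) \<phi>"
    by (rule homotopic_with_mono) (use tN tW NW in \<open>auto simp: equivariant_def\<close>)
  with 1 have "G_homotopic G ?N ?d ?E ?d (\<lambda>e. path_ends (s (\<phi> e))) (\<lambda>x. x)"
    unfolding G_homotopic_def by (blast intro: homotopic_with_trans homotopic_with_symD)
  then show ?thesis
    using No Ni \<sigma> unfolding G_sectional_def N_def[symmetric] by blast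
qed

theorem proposition7p3:
  fixes G :: "('g, 'm) monoid_scheme" and T :: "'g topology"
    and E :: "'e topology" and a :: "'g \<Rightarrow> 'e \<Rightarrow> 'e"
    and B :: "'b topology" and b :: "'g \<Rightarrow> 'b \<Rightarrow> 'b"
    and p :: "'e \<Rightarrow> 'b" and b0 :: 'b and F :: "'e topology"
  assumes "compact_Lie_group G T"
    and "G_space G T E a" and "G_space G T B b" and "t0_space B"
    and "G_fibration G T E a B b p"
    and "G_connected G T B b" and "fixed_points (carrier G) B b \<noteq> {}"
    and "b0 \<in> fixed_points (carrier G) B b"
    and "F = subtopology E {e \<in> topspace E. p e = b0}"
  shows "TC_G G E a + 1 \<le> (TC_G G F a + 1) * (cat_G G (prod_topology B B) (diag_act b b) + 1)"
proof (cases "TC_G G F a = \<infinity> \<or> cat_G G (prod_topology B B) (diag_act b b) = \<infinity>")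
  case True
  then have "(TC_G G F a + 1) * (cat_G G (prod_topology B B) (diag_act b b) + 1) = \<infinity>"
    by (auto simp: imult_is_infinity)
  then show ?thesis by simp
next
  case False
  let ?E = "prod_topology E E" and ?B = "prod_topology B B" and ?F = "prod_topology F F"
  let ?a = "diag_act a a" and ?b = "diag_act b b"
  have G: "topological_group G T" and comp: "compact_space T"
    using assms(1) by (auto simp: compact_Lie_group_def Lie_group_def)
  have EE: "G_space G T ?E ?a" and BB: "G_space G T ?B ?b"
    using G_space_prod assms(2,3) by blast+
  have pm: "G_map G E a B b p" using assms(5) by (simp add: G_fibration_def)
  have ppm: "G_map G ?E ?a ?B ?b (map_prod p p)"
  proof -
    have "continuous_map ?E B (p \<circ> fst)" "continuous_map ?E B (p \<circ> snd)"
      using pm by (auto simp: G_map_def intro: continuous_map_compose continuous_map_fst continuous_map_snd)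
    from continuous_map_pairedI[OF this] show ?thesis
      using pm by (auto simp: G_map_def equivariant_def diag_act_def map_prod_def case_prod_unfold)
  qed
  have b00: "(b0, b0) \<in> fixed_points (carrier G) ?B ?b" using assms(8) by (simp add: fixed_points_prod)
  obtain m where m: "TC_G G F a = enat m" using False by auto
  then obtain V where V: "(\<Union>i\<le>m. V i) = topspace ?F"
      "\<And>i. i \<le> m \<Longrightarrow> G_sectional G (path_space F) (path_act a) ?F ?a path_ends (V i)"
    using secat_G_attained[of G "path_space F" "path_act a" ?F ?a path_ends m] unfolding TC_G_def by blast
  obtain n where n: "cat_G G ?B ?b = enat n" using False by auto
  then obtain U where U: "(\<Union>j\<le>n. U j) = topspace ?B" "\<And>j. j \<le> n \<Longrightarrow> G_categorical G ?B ?b (U j)"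
    by (rule cat_G_attained) blast
  define W where "W j = {e \<in> topspace ?E. map_prod p p e \<in> U j}" for j
  have "\<exists>\<phi>. openin ?E (W j) \<and> G_invariant G ?a (W j) \<and>
      G_homotopic G (subtopology ?E (W j)) ?a ?E ?a (\<lambda>x. x) \<phi> \<and>
      (\<forall>e\<in>W j. \<phi> e \<in> topspace ?F)" if j: "j \<le> n" for j
  proof -
    have Uj: "openin ?B (U j)" "G_invariant G ?b (U j)" using U(2)[OF j] by (auto simp: G_categorical_def)
    have Einv: "G_invariant G ?a (topspace ?E)"
      using G_space_closed[OF G EE] by (simp add: G_invariant_def)
    have Wj: "G_invariant G ?a (W j)"
      using Einv Uj(2) ppm by (auto simp: W_def G_invariant_def G_map_def equivariant_def)
    have "G_lifting G (subtopology ?E (W j)) ?a E a B b p"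
      by (rule G_fibration_lifting[OF G assms(2,3) G_space_subtopology[OF G EE Wj] assms(5)])
    then have lift: "G_lifting G (subtopology ?E (W j)) ?a ?E ?a ?B ?b (map_prod p p)"
      by (intro G_lifting_prod)
    have contr: "G_homotopic G (subtopology ?B (U j)) ?b ?B ?b (\<lambda>x. x) (\<lambda>_. (b0, b0))"
      by (rule G_categorical_contractible_to_fixed_point[OF G comp BB
            t0_space_prod_topologyI[OF assms(4,4)] G_connected_prod[OF assms(6,6)] b00 U(2)[OF j]])
    obtain \<phi> where \<phi>: "openin ?E (W j)" "G_invariant G ?a (W j)"
        "G_homotopic G (subtopology ?E (W j)) ?a ?E ?a (\<lambda>x. x) \<phi>"
        "\<And>e. e \<in> W j \<Longrightarrow> \<phi> e \<in> topspace ?E \<and> map_prod p p (\<phi> e) = (b0, b0)"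
      using lift_contraction_into_fibre[OF ppm Einv Uj W_def lift contr] by metis
    have "\<phi> e \<in> topspace ?F" if "e \<in> W j" for e
      using \<phi>(4)[OF that] by (cases "\<phi> e") (simp add: assms(9))
    with \<phi> show ?thesis by blast
  qed
  then obtain \<phi> where \<phi>: "\<And>j. j \<le> n \<Longrightarrow> openin ?E (W j)" "\<And>j. j \<le> n \<Longrightarrow> G_invariant G ?a (W j)"
      "\<And>j. j \<le> n \<Longrightarrow> G_homotopic G (subtopology ?E (W j)) ?a ?E ?a (\<lambda>x. x) (\<phi> j)"
      "\<And>j e. j \<le> n \<Longrightarrow> e \<in> W j \<Longrightarrow> \<phi> j e \<in> topspace ?F"
    by metis
  define N where "N i j = {e \<in> W j. \<phi> j e \<in> V i}" for i j
  have "TC_G G E a + 1 \<le> (enat m + 1) * (enat n + 1)"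
    unfolding TC_G_def
  proof (rule secat_G_le_double_cover[where N = N])
    show "G_sectional G (path_space E) (path_act a) ?E ?a path_ends (N i j)" if "i \<le> m" "j \<le> n" for i j
      unfolding N_def
      by (rule G_sectional_path_ends_pullback[OF assms(9) \<phi>(1,2)[OF that(2)] \<phi>(4)[OF that(2)]
            \<phi>(3)[OF that(2)] V(2)[OF that(1)]])
    show "(\<Union>i\<le>m. \<Union>j\<le>n. N i j) = topspace ?E"
    proof (intro equalityI subsetI)
      fix e assume e: "e \<in> topspace ?E"
      then have "map_prod p p e \<in> topspace ?B" using ppm by (auto simp: G_map_def continuous_map_def)
      then obtain j where j: "j \<le> n" "e \<in> W j" using U(1) e unfolding W_def by blast
      then obtain i where "i \<le> m" "\<phi> j e \<in> V i" using \<phi>(4)[OF j] V(1) by blast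
      then show "e \<in> (\<Union>i\<le>m. \<Union>j\<le>n. N i j)" using j by (auto simp: N_def)
    qed (auto simp: N_def W_def)
  qed
  then show ?thesis by (simp add: m n)
qed

end
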